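(* Let $\Gamma$ be a finitely generated discrete group with the right-invariant word metric $d$. If the inclusion $C^*_r(\Gamma)\subseteq UC^*(\Gamma)$ (given by the left regular representation) is a nuclear map, then $\Gamma$, as the metric space $(\Gamma,d)$, is uniformly embeddable in a Hilbert space.
   Context: Fix a finite symmetric generating set of $\Gamma$ with word length $l$, and let $d(s,t)=l(st^{-1})$. The left regular representation $\lambda$ of $\Gamma$ on $\ell^2(\Gamma)$ is $\lambda_t\delta_r=\delta_{tr}$, where $\delta_r$ is the indicator of $r$; $C^*_r(\Gamma)$ is the norm closure of the span of $\{\lambda_t\}$ in $\mathcal{B}(\ell^2(\Gamma))$. A finite width operator is a function $A:\Gamma\times\Gamma\to\mathbb{C}$ that is bounded and for which there is $R>0$ with $A(s,t)=0$ whenever $d(s,t)>R$; it acts on $\ell^2(\Gamma)$ by $(A\xi)(s)=\sum_r A(s,r)\xi(r)$. The uniform Roe algebra $UC^*(\Gamma)$ is the norm closure in $\mathcal{B}(\ell^2(\Gamma))$ of the $*$-algebra of finite width operators; it contains $C^*_r(\Gamma)$. The inclusion $C^*_r(\Gamma)\to UC^*(\Gamma)$ is nuclear if there is a net $T_\lambda:C^*_r(\Gamma)\to UC^*(\Gamma)$ of finite rank, unital, completely positive linear maps with $\|T_\lambda(x)-x\|\to0$ for all $x\in C^*_r(\Gamma)$. A map $f$ from a metric space $(X,d)$ to a separable Hilbert space is a uniform embedding if there exist non-decreasing proper functions $\rho_\pm:[0,\infty)\to[0,\infty)$ with $\rho_-(d(x,y))\le\|f(x)-f(y)\|\le\rho_+(d(x,y))$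 for all $x,y$. *)

theory Defs
  imports "HOL-Algebra.Generated_Groups" "HOL-Analysis.Analysis"
begin

type_synonym 'a kernel = "'a \<Rightarrow> 'a \<Rightarrow> complex"

definition word_length :: "('a, 'b) monoid_scheme \<Rightarrow> 'a set \<Rightarrow> 'a \<Rightarrow> nat" where
  "word_length G S g =
     (LEAST n. \<exists>xs. length xs = n \<and> set xs \<subseteq> S \<and> foldr (\<otimes>\<^bsub>G\<^esub>) xs \<one>\<^bsub>G\<^esub> = g)"

definition word_dist :: "('a, 'b) monoid_scheme \<Rightarrow> 'a set \<Rightarrow> 'a \<Rightarrow> 'a \<Rightarrow> nat" where
  "word_dist G S s t = word_length G S (s \<otimes>\<^bsub>G\<^esub> inv\<^bsub>G\<^esub> t)"

definition l2 :: "('a, 'b) monoid_scheme \<Rightarrow> ('a \<Rightarrow> complex) set" where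
  "l2 G = {\<xi>. (\<forall>x. x \<notin> carrier G \<longrightarrow> \<xi> x = 0) \<and>
              (\<lambda>x. (cmod (\<xi> x))\<^sup>2) summable_on carrier G}"

definition l2norm :: "('a, 'b) monoid_scheme \<Rightarrow> ('a \<Rightarrow> complex) \<Rightarrow> real" where
  "l2norm G \<xi> = sqrt (\<Sum>\<^sub>\<infinity>x\<in>carrier G. (cmod (\<xi> x))\<^sup>2)"

definition l2inner :: "('a, 'b) monoid_scheme \<Rightarrow> ('a \<Rightarrow> complex) \<Rightarrow> ('a \<Rightarrow> complex) \<Rightarrow> complex" where
  "l2inner G \<xi> \<eta> = (\<Sum>\<^sub>\<infinity>x\<in>carrier G. \<xi> x * cnj (\<eta> x))"

definition kapply :: "('a, 'b) monoid_scheme \<Rightarrow> 'a kernel \<Rightarrow> ('a \<Rightarrow> complex) \<Rightarrow> ('a \<Rightarrow> complex)" where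
  "kapply G A \<xi> = (\<lambda>s. if s \<in> carrier G then (\<Sum>\<^sub>\<infinity>r\<in>carrier G. A s r * \<xi> r) else 0)"

text \<open>A matrix (supported on Gamma x Gamma) defines a bounded operator on l2(Gamma).
  Every bounded operator on l2(Gamma) arises this way from a unique such matrix.\<close>
definition bounded_op :: "('a, 'b) monoid_scheme \<Rightarrow> 'a kernel \<Rightarrow> bool" where
  "bounded_op G A \<longleftrightarrow>
     (\<forall>s r. (s \<notin> carrier G \<or> r \<notin> carrier G) \<longrightarrow> A s r = 0) \<and>
     (\<forall>s\<in>carrier G. A s \<in> l2 G) \<and>
     (\<exists>C. \<forall>\<xi>\<in>l2 G. kapply G A \<xi> \<in> l2 G \<and> l2norm G (kapply G A \<xi>) \<le> C * l2norm G \<xi>)"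

definition opnorm :: "('a, 'b) monoid_scheme \<Rightarrow> 'a kernel \<Rightarrow> real" where
  "opnorm G A = (SUP \<xi>\<in>{\<xi>\<in>l2 G. l2norm G \<xi> \<le> 1}. l2norm G (kapply G A \<xi>))"

definition kdiff :: "'a kernel \<Rightarrow> 'a kernel \<Rightarrow> 'a kernel" where
  "kdiff A B = (\<lambda>s r. A s r - B s r)"

definition lreg :: "('a, 'b) monoid_scheme \<Rightarrow> 'a \<Rightarrow> 'a kernel" where
  "lreg G t = (\<lambda>s r. if s \<in> carrier G \<and> r \<in> carrier G \<and> s = t \<otimes>\<^bsub>G\<^esub> r then 1 else 0)"

definition reduced_cstar :: "('a, 'b) monoid_scheme \<Rightarrow> 'a kernel set" where
  "reduced_cstar G = {x. bounded_op G x \<and>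
     (\<forall>\<epsilon>>0. \<exists>F c. finite F \<and> F \<subseteq> carrier G \<and>
        opnorm G (kdiff x (\<lambda>s r. \<Sum>t\<in>F. c t * lreg G t s r)) < \<epsilon>)}"

definition finite_width :: "('a, 'b) monoid_scheme \<Rightarrow> 'a set \<Rightarrow> 'a kernel \<Rightarrow> bool" where
  "finite_width G S A \<longleftrightarrow>
     (\<forall>s r. (s \<notin> carrier G \<or> r \<notin> carrier G) \<longrightarrow> A s r = 0) \<and>
     (\<exists>M. \<forall>s r. cmod (A s r) \<le> M) \<and>
     (\<exists>R>0. \<forall>s\<in>carrier G. \<forall>t\<in>carrier G. real (word_dist G S s t) > R \<longrightarrow> A s t = 0)"

definition uniform_roe :: "('a, 'b) monoid_scheme \<Rightarrow> 'a set \<Rightarrow> 'a kernel set" where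
  "uniform_roe G S = {x. bounded_op G x \<and>
     (\<forall>\<epsilon>>0. \<exists>y. finite_width G S y \<and> bounded_op G y \<and> opnorm G (kdiff x y) < \<epsilon>)}"

text \<open>An n x n matrix of operators is positive iff it is a positive operator on (l2)^n.\<close>
definition pos_opmatrix :: "('a, 'b) monoid_scheme \<Rightarrow> nat \<Rightarrow> (nat \<Rightarrow> nat \<Rightarrow> 'a kernel) \<Rightarrow> bool" where
  "pos_opmatrix G n X \<longleftrightarrow>
     (\<forall>\<eta>. (\<forall>i<n. \<eta> i \<in> l2 G) \<longrightarrow>
        (let z = (\<Sum>i<n. \<Sum>j<n. l2inner G (kapply G (X i j) (\<eta> j)) (\<eta> i)) in Im z = 0 \<and> Re z \<ge> 0))"

definition completely_positive_on ::
    "('a, 'b) monoid_scheme \<Rightarrow> 'a kernel set \<Rightarrow> ('a kernel \<Rightarrow> 'a kernel) \<Rightarrow> bool" where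
  "completely_positive_on G A T \<longleftrightarrow>
     (\<forall>n X. (\<forall>i<n. \<forall>j<n. X i j \<in> A) \<longrightarrow> pos_opmatrix G n X \<longrightarrow>
            pos_opmatrix G n (\<lambda>i j. T (X i j)))"

definition linear_on :: "'a kernel set \<Rightarrow> ('a kernel \<Rightarrow> 'a kernel) \<Rightarrow> bool" where
  "linear_on A T \<longleftrightarrow>
     (\<forall>x\<in>A. \<forall>y\<in>A. \<forall>a b::complex.
        T (\<lambda>s r. a * x s r + b * y s r) = (\<lambda>s r. a * T x s r + b * T y s r))"

definition finite_rank_on :: "'a kernel set \<Rightarrow> ('a kernel \<Rightarrow> 'a kernel) \<Rightarrow> bool" where
  "finite_rank_on A T \<longleftrightarrow>
     (\<exists>F. finite F \<and> (\<forall>x\<in>A. \<exists>c. T x = (\<lambda>s r. \<Sum>f\<in>F. c f * f s r)))"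

definition fr_ucp_map :: "('a, 'b) monoid_scheme \<Rightarrow> 'a set \<Rightarrow> ('a kernel \<Rightarrow> 'a kernel) \<Rightarrow> bool" where
  "fr_ucp_map G S T \<longleftrightarrow>
     (\<forall>x\<in>reduced_cstar G. T x \<in> uniform_roe G S) \<and>
     linear_on (reduced_cstar G) T \<and>
     finite_rank_on (reduced_cstar G) T \<and>
     T (lreg G \<one>\<^bsub>G\<^esub>) = lreg G \<one>\<^bsub>G\<^esub> \<and>
     completely_positive_on G (reduced_cstar G) T"

definition directed_order :: "('i \<Rightarrow> 'i \<Rightarrow> bool) \<Rightarrow> bool" where
  "directed_order leq \<longleftrightarrow> (\<forall>i. leq i i) \<and> (\<forall>i j k. leq i j \<longrightarrow> leq j k \<longrightarrow> leq i k) \<and>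
     (\<forall>i j. \<exists>k. leq i k \<and> leq j k)"

section \<open>Uniform embedding into a separable Hilbert space (realised as l2(N))\<close>

definition l2seq_dist :: "(nat \<Rightarrow> real) \<Rightarrow> (nat \<Rightarrow> real) \<Rightarrow> real" where
  "l2seq_dist u v = sqrt (\<Sum>n. (u n - v n)\<^sup>2)"

definition proper_control :: "(real \<Rightarrow> real) \<Rightarrow> bool" where
  "proper_control \<rho> \<longleftrightarrow> mono_on {0..} \<rho> \<and> (\<forall>t\<ge>0. \<rho> t \<ge> 0) \<and> filterlim \<rho> at_top at_top"

definition uniformly_embeddable :: "('a, 'b) monoid_scheme \<Rightarrow> 'a set \<Rightarrow> bool" where
  "uniformly_embeddable G S \<longleftrightarrow>
     (\<exists>f :: 'a \<Rightarrow> nat \<Rightarrow> real.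
        (\<forall>x\<in>carrier G. summable (\<lambda>n. (f x n)\<^sup>2)) \<and>
        (\<exists>\<rho>m \<rho>p. proper_control \<rho>m \<and> proper_control \<rho>p \<and>
           (\<forall>x\<in>carrier G. \<forall>y\<in>carrier G.
              \<rho>m (real (word_dist G S x y)) \<le> l2seq_dist (f x) (f y) \<and>
              l2seq_dist (f x) (f y) \<le> \<rho>p (real (word_dist G S x y)))))"

end

theory Submission
  imports Defs "HOL-Algebra.Divisibility" "HOL-Library.Function_Algebras"
begin

text \<open>A finite rank unital completely positive map \<open>T\<close> yields the kernel
  \<open>u(s,t) = Re \<langle>T(\<lambda>\<^sub>s \<lambda>\<^sub>t\<^sup>*) \<delta>\<^sub>t, \<delta>\<^sub>s\<rangle>\<close>, which is positive definite with \<open>u(s,s) = 1\<close>. It is close to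
  1 on a strip \<open>d(s,t) \<le> r\<close> when \<open>T\<close> is close to the identity on the finitely many \<open>\<lambda>\<^sub>g\<close> with
  \<open>l(g) \<le> r\<close>. It tends to 0 as \<open>d(s,t) \<rightarrow> \<infinity>\<close>: the entries of each \<open>T(\<lambda>\<^sub>g)\<close> decay off the diagonal
  because it lies in the Roe algebra, and they do so uniformly in \<open>g\<close> because the \<open>T(\<lambda>\<^sub>g)\<close> form a
  bounded subset of a finite dimensional space. Choosing \<open>u\<^sub>n\<close> with \<open>\<bar>1 - u\<^sub>n(s,t)\<bar> \<le> 2\<^sup>-\<^sup>n\<close> for
  \<open>d(s,t) \<le> n\<close>, the function \<open>\<Sum>\<^sub>n 2 (1 - u\<^sub>n(s,t))\<close> is of negative type, hence a squared Hilbert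
  space distance; it is bounded on strips and tends to infinity with \<open>d(s,t)\<close>.\<close>

section \<open>Positive definite kernels\<close>

definition kernel_form :: "('x \<Rightarrow> 'x \<Rightarrow> real) \<Rightarrow> nat \<Rightarrow> (nat \<Rightarrow> 'x) \<Rightarrow> (nat \<Rightarrow> real) \<Rightarrow> real" where
  "kernel_form K n g c = (\<Sum>i<n. \<Sum>j<n. c i * c j * K (g i) (g j))"

definition pd_kernel :: "'x set \<Rightarrow> ('x \<Rightarrow> 'x \<Rightarrow> real) \<Rightarrow> bool" where
  "pd_kernel X K \<longleftrightarrow> (\<forall>x\<in>X. \<forall>y\<in>X. K x y = K y x) \<and>
     (\<forall>n g c. (\<forall>i<n. g i \<in> X) \<longrightarrow> 0 \<le> kernel_form K n g c)"

lemma kernel_form_Suc: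
  assumes "\<And>i. i < n \<Longrightarrow> K x (g i) = K (g i) x"
  shows "kernel_form K (Suc n) (g(n := x)) (c(n := t)) =
    kernel_form K n g c + 2 * t * (\<Sum>i<n. c i * K (g i) x) + t\<^sup>2 * K x x"
proof -
  have "(\<Sum>i<n. t * c i * K x (g i)) = t * (\<Sum>i<n. c i * K (g i) x)"
    using assms by (simp add: sum_distrib_left mult.assoc)
  then show ?thesis
    by (simp add: kernel_form_def sum.distrib sum_distrib_left power2_eq_square mult_ac)
qed

lemma pd_kernel_sym: "pd_kernel X K \<Longrightarrow> x \<in> X \<Longrightarrow> y \<in> X \<Longrightarrow> K x y = K y x"
  by (simp add: pd_kernel_def)

lemma pd_kernel_form_nonneg:
  "pd_kernel X K \<Longrightarrow> (\<And>i. i < n \<Longrightarrow> g i \<in> X) \<Longrightarrow> 0 \<le> kernel_form K n g c"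
  by (simp add: pd_kernel_def)

lemma pd_kernel_compose:
  assumes "pd_kernel X K" "\<And>y. y \<in> Y \<Longrightarrow> h y \<in> X"
  shows "pd_kernel Y (\<lambda>y z. K (h y) (h z))"
  unfolding pd_kernel_def
proof (intro conjI ballI allI impI)
  fix n and g :: "nat \<Rightarrow> 'b" and c :: "nat \<Rightarrow> real"
  assume "\<forall>i<n. g i \<in> Y"
  then have "0 \<le> kernel_form K n (h \<circ> g) c"
    using assms by (intro pd_kernel_form_nonneg) auto
  then show "0 \<le> kernel_form (\<lambda>y z. K (h y) (h z)) n g c"
    by (simp add: kernel_form_def)
qed (use assms(2) pd_kernel_sym[OF assms(1)] in simp)

lemma pd_kernel_two_points:
  assumes "pd_kernel X K" "x \<in> X" "y \<in> X"
  shows "0 \<le> a\<^sup>2 * K x x + 2 * a * b * K x y + b\<^sup>2 * K y y"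
proof -
  have "0 \<le> kernel_form K (Suc 1) ((\<lambda>_. x)(1 := y)) ((\<lambda>_. a)(1 := b))"
    using assms by (intro pd_kernel_form_nonneg) auto
  also have "\<dots> = a\<^sup>2 * K x x + 2 * a * b * K x y + b\<^sup>2 * K y y"
    using pd_kernel_sym[OF assms]
    by (subst kernel_form_Suc) (simp_all add: kernel_form_def power2_eq_square)
  finally show ?thesis .
qed

lemma pd_kernel_diag_nonneg: "pd_kernel X K \<Longrightarrow> x \<in> X \<Longrightarrow> 0 \<le> K x x"
  using pd_kernel_two_points[of X K x x 1 0] by simp

lemma pd_kernel_Cauchy_Schwarz:
  assumes "pd_kernel X K" "x \<in> X" "y \<in> X"
  shows "(K x y)\<^sup>2 \<le> K x x * K y y"
proof (cases "K x x = 0")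
  case True
  have "K x y = 0"
  proof (rule ccontr)
    assume "K x y \<noteq> 0"
    then show False
      using pd_kernel_two_points[OF assms, of "- (K y y + 1) / (2 * K x y)" 1] True
      by (simp add: field_simps)
  qed
  then show ?thesis using True by simp
next
  case False
  then have "0 < K x x" using pd_kernel_diag_nonneg assms by (simp add: order.strict_iff_order)
  moreover have "0 \<le> K x x * (K x x * K y y - (K x y)\<^sup>2)"
    using pd_kernel_two_points[OF assms, of "- K x y" "K x x"]
    by (simp add: power2_eq_square algebra_simps)
  ultimately show ?thesis
    by (simp add: zero_le_mult_iff)
qed

lemma pd_kernel_Schur_complement:
  assumes pd: "pd_kernel X K" and x_in: "x \<in> X"
  shows "pd_kernel X (\<lambda>y z. K y z - K y x * K z x / K x x)" (is "pd_kernel X ?K'")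
  unfolding pd_kernel_def
proof (intro conjI ballI allI impI)
  fix y z assume "y \<in> X" "z \<in> X"
  then show "?K' y z = ?K' z y"
    using pd_kernel_sym[OF pd] by (simp add: mult.commute)
next
  fix n and g :: "nat \<Rightarrow> 'a" and c :: "nat \<Rightarrow> real"
  assume g_in: "\<forall>i<n. g i \<in> X"
  define b where "b = (\<Sum>i<n. c i * K (g i) x)"
  have "b * b = (\<Sum>i<n. \<Sum>j<n. c i * c j * (K (g i) x * K (g j) x))"
    unfolding b_def sum_product by (simp add: mult_ac)
  then have "kernel_form ?K' n g c = kernel_form K n g c - b * b / K x x"
    by (simp add: kernel_form_def algebra_simps sum_subtractf sum_divide_distrib)
  also have "\<dots> = kernel_form K n g c + 2 * (- b / K x x) * b + (- b / K x x)\<^sup>2 * K x x"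
    by (cases "K x x = 0") (simp_all add: field_simps power2_eq_square)
  also have "\<dots> = kernel_form K (Suc n) (g(n := x)) (c(n := - b / K x x))"
    unfolding b_def using g_in x_in by (intro kernel_form_Suc[symmetric] pd_kernel_sym[OF pd]) auto
  also have "\<dots> \<ge> 0"
    using g_in x_in by (intro pd_kernel_form_nonneg[OF pd]) (auto simp: less_Suc_eq)
  finally show "0 \<le> kernel_form ?K' n g c" .
qed

section \<open>Realization in Hilbert space\<close>

fun Schur_iterate :: "(nat \<Rightarrow> nat \<Rightarrow> real) \<Rightarrow> nat \<Rightarrow> nat \<Rightarrow> nat \<Rightarrow> real" where
  "Schur_iterate K 0 i j = K i j"
| "Schur_iterate K (Suc n) i j =
     Schur_iterate K n i j - Schur_iterate K n i n * Schur_iterate K n j n / Schur_iterate K n n n"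

text \<open>A zero pivot does no harm: its whole column vanishes, and \<open>x / 0 = 0\<close>.\<close>

definition Cholesky_factor :: "(nat \<Rightarrow> nat \<Rightarrow> real) \<Rightarrow> nat \<Rightarrow> nat \<Rightarrow> real" where
  "Cholesky_factor K i n = Schur_iterate K n i n / sqrt (Schur_iterate K n n n)"

lemma pd_kernel_Schur_iterate: "pd_kernel UNIV K \<Longrightarrow> pd_kernel UNIV (Schur_iterate K n)"
  by (induction n) (simp_all add: pd_kernel_Schur_complement Schur_iterate.simps[abs_def])

lemma Schur_iterate_eq_0:
  assumes pd: "pd_kernel UNIV K" and "i < n"
  shows "Schur_iterate K n i j = 0"
  using \<open>i < n\<close>
proof (induction n arbitrary: i j)
  case (Suc n)
  let ?Q = "Schur_iterate K n"
  have pd_iterate: "pd_kernel UNIV ?Q" by (rule pd_kernel_Schur_iterate[OF pd])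
  show ?case
  proof (cases "i = n")
    case True
    have "?Q n j = 0" if "?Q n n = 0"
      using pd_kernel_Cauchy_Schwarz[OF pd_iterate, of n j] that by simp
    then show ?thesis using True pd_kernel_sym[OF pd_iterate, of n j] by auto
  next
    case False
    then show ?thesis using Suc by simp
  qed
qed simp

lemma Cholesky_factor_eq_0: "pd_kernel UNIV K \<Longrightarrow> i < n \<Longrightarrow> Cholesky_factor K i n = 0"
  by (simp add: Cholesky_factor_def Schur_iterate_eq_0)

lemma Cholesky_factor_sums:
  assumes pd: "pd_kernel UNIV K"
  shows "(\<lambda>m. Cholesky_factor K i m * Cholesky_factor K j m) sums K i j"
proof -
  let ?L = "Cholesky_factor K"
  have "?L i n * ?L j n = Schur_iterate K n i n * Schur_iterate K n j n / Schur_iterate K n n n" for n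
    using pd_kernel_diag_nonneg[OF pd_kernel_Schur_iterate[OF pd], of n n]
    by (simp add: Cholesky_factor_def)
  then have "K i j = (\<Sum>m<n. ?L i m * ?L j m) + Schur_iterate K n i j" for n
    by (induction n) simp_all
  then have "K i j = (\<Sum>m<Suc i. ?L i m * ?L j m)"
    using Schur_iterate_eq_0[OF pd lessI] by (metis add.right_neutral)
  then show ?thesis
    using sums_finite[of "{..<Suc i}" "\<lambda>m. ?L i m * ?L j m"] Cholesky_factor_eq_0[OF pd] by simp
qed

lemma pd_kernel_realization:
  assumes pd: "pd_kernel X K" and countable: "countable X"
  obtains f :: "'x \<Rightarrow> nat \<Rightarrow> real" where
    "\<And>x y. x \<in> X \<Longrightarrow> y \<in> X \<Longrightarrow> (\<lambda>n. f x n * f y n) sums K x y"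
proof (cases "X = {}")
  case False
  let ?K = "\<lambda>i j. K (from_nat_into X i) (from_nat_into X j)"
  have "pd_kernel UNIV ?K"
    by (rule pd_kernel_compose[OF pd]) (simp add: from_nat_into False)
  then have "(\<lambda>n. Cholesky_factor ?K (to_nat_on X x) n * Cholesky_factor ?K (to_nat_on X y) n)
      sums K x y"
    if "x \<in> X" "y \<in> X" for x y
    using Cholesky_factor_sums[of ?K "to_nat_on X x" "to_nat_on X y"] that countable by simp
  then show ?thesis
    by (rule that[of "\<lambda>x. Cholesky_factor ?K (to_nat_on X x)"])
qed (use that in simp)

section \<open>Kernels of negative type\<close>

definition neg_type_kernel :: "'x set \<Rightarrow> ('x \<Rightarrow> 'x \<Rightarrow> real) \<Rightarrow> bool" where
  "neg_type_kernel X \<psi> \<longleftrightarrow> (\<forall>x\<in>X. \<psi> x x = 0) \<and> (\<forall>x\<in>X. \<forall>y\<in>X. \<psi> x y = \<psi> y x) \<and>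
     (\<forall>n g c. (\<forall>i<n. g i \<in> X) \<longrightarrow> (\<Sum>i<n. c i) = 0 \<longrightarrow> kernel_form \<psi> n g c \<le> 0)"

lemma neg_type_kernel_diag: "neg_type_kernel X \<psi> \<Longrightarrow> x \<in> X \<Longrightarrow> \<psi> x x = 0"
  by (simp add: neg_type_kernel_def)

lemma neg_type_kernel_sym: "neg_type_kernel X \<psi> \<Longrightarrow> x \<in> X \<Longrightarrow> y \<in> X \<Longrightarrow> \<psi> x y = \<psi> y x"
  by (simp add: neg_type_kernel_def)

lemma neg_type_kernel_form_nonpos:
  "neg_type_kernel X \<psi> \<Longrightarrow> (\<And>i. i < n \<Longrightarrow> g i \<in> X) \<Longrightarrow> (\<Sum>i<n. c i) = 0 \<Longrightarrow> kernel_form \<psi> n g c \<le> 0"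
  by (simp add: neg_type_kernel_def)

lemma neg_type_kernel_nonneg:
  assumes "neg_type_kernel X \<psi>" "x \<in> X" "y \<in> X"
  shows "0 \<le> \<psi> x y"
proof -
  have "kernel_form \<psi> (Suc 1) ((\<lambda>_. x)(1 := y)) ((\<lambda>_. 1)(1 := - 1)) \<le> 0"
    by (rule neg_type_kernel_form_nonpos[OF assms(1)]) (use assms in auto)
  also have "kernel_form \<psi> (Suc 1) ((\<lambda>_. x)(1 := y)) ((\<lambda>_. 1)(1 := - 1)) = - 2 * \<psi> x y"
    using assms by (subst kernel_form_Suc)
      (simp_all add: kernel_form_def neg_type_kernel_diag neg_type_kernel_sym[OF assms])
  finally show ?thesis by simp
qed

lemma neg_type_kernel_of_pd_kernel:
  assumes pd: "pd_kernel X K"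
  shows "neg_type_kernel X (\<lambda>x y. K x x + K y y - 2 * K x y)" (is "neg_type_kernel X ?\<psi>")
  unfolding neg_type_kernel_def
proof (intro conjI ballI allI impI)
  fix n and g :: "nat \<Rightarrow> 'a" and c :: "nat \<Rightarrow> real"
  assume g_in: "\<forall>i<n. g i \<in> X" and sum_c: "(\<Sum>i<n. c i) = 0"
  have "(\<Sum>i<n. \<Sum>j<n. c i * c j * K (g i) (g i)) = (\<Sum>i<n. c i * K (g i) (g i)) * (\<Sum>j<n. c j)"
    unfolding sum_product by (simp add: mult_ac)
  moreover have "(\<Sum>i<n. \<Sum>j<n. c i * c j * K (g j) (g j)) = (\<Sum>i<n. c i) * (\<Sum>j<n. c j * K (g j) (g j))"
    unfolding sum_product by (simp add: mult_ac)
  ultimately have "kernel_form ?\<psi> n g c = - 2 * kernel_form K n g c"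
    by (simp add: kernel_form_def sum_c algebra_simps sum.distrib sum_subtractf sum_negf
        sum_distrib_left)
  then show "kernel_form ?\<psi> n g c \<le> 0"
    using g_in pd_kernel_form_nonneg[OF pd, of n g c] by simp
qed (use pd_kernel_sym[OF pd] in auto)

lemma neg_type_kernel_suminf:
  assumes neg_type: "\<And>k :: nat. neg_type_kernel X (\<psi> k)"
    and summable: "\<And>x y. x \<in> X \<Longrightarrow> y \<in> X \<Longrightarrow> summable (\<lambda>k. \<psi> k x y)"
  shows "neg_type_kernel X (\<lambda>x y. \<Sum>k. \<psi> k x y)"
  unfolding neg_type_kernel_def
proof (intro conjI ballI allI impI)
  fix n and g :: "nat \<Rightarrow> 'a" and c :: "nat \<Rightarrow> real"
  assume g_in: "\<forall>i<n. g i \<in> X" and sum_c: "(\<Sum>i<n. c i) = 0"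
  have "(\<lambda>k. kernel_form (\<psi> k) n g c) sums kernel_form (\<lambda>x y. \<Sum>k. \<psi> k x y) n g c"
    unfolding kernel_form_def using g_in by (intro sums_sum sums_mult summable_sums summable) auto
  then show "kernel_form (\<lambda>x y. \<Sum>k. \<psi> k x y) n g c \<le> 0"
    by (rule sums_le[OF _ _ sums_zero, rotated])
      (use g_in sum_c in \<open>auto intro: neg_type_kernel_form_nonpos[OF neg_type]\<close>)
qed (use neg_type_kernel_diag[OF neg_type] neg_type_kernel_sym[OF neg_type] in auto)

lemma neg_type_kernel_centered_pd:
  assumes neg_type: "neg_type_kernel X \<psi>" and e_in: "e \<in> X"
  shows "pd_kernel X (\<lambda>x y. (\<psi> x e + \<psi> y e - \<psi> x y) / 2)" (is "pd_kernel X ?K")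
  unfolding pd_kernel_def
proof (intro conjI ballI allI impI)
  fix n and g :: "nat \<Rightarrow> 'a" and c :: "nat \<Rightarrow> real"
  assume g_in: "\<forall>i<n. g i \<in> X"
  define s where "s = (\<Sum>i<n. c i)"
  define b where "b = (\<Sum>i<n. c i * \<psi> (g i) e)"
  have b_times_s: "b * s = (\<Sum>i<n. \<Sum>j<n. c i * c j * \<psi> (g i) e)"
    and s_times_b: "s * b = (\<Sum>i<n. \<Sum>j<n. c i * c j * \<psi> (g j) e)"
    unfolding s_def b_def sum_product by (simp_all add: mult_ac)
  have "2 * kernel_form ?K n g c =
      (\<Sum>i<n. \<Sum>j<n. c i * c j * \<psi> (g i) e + c i * c j * \<psi> (g j) e - c i * c j * \<psi> (g i) (g j))"
    unfolding kernel_form_def sum_distrib_left by (intro sum.cong refl) (simp add: field_simps)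
  also have "\<dots> = b * s + s * b - kernel_form \<psi> n g c"
    unfolding b_times_s s_times_b kernel_form_def sum.distrib sum_subtractf ..
  also have "\<dots> = - (kernel_form \<psi> n g c + 2 * (- s) * b + (- s)\<^sup>2 * \<psi> e e)"
    using neg_type_kernel_diag[OF neg_type e_in] by simp
  also have "\<dots> = - kernel_form \<psi> (Suc n) (g(n := e)) (c(n := - s))"
    unfolding b_def using g_in e_in neg_type_kernel_sym[OF neg_type] by (subst kernel_form_Suc) auto
  also have "\<dots> \<ge> 0"
  proof -
    have "kernel_form \<psi> (Suc n) (g(n := e)) (c(n := - s)) \<le> 0"
      by (rule neg_type_kernel_form_nonpos[OF neg_type])
        (use g_in e_in in \<open>auto simp: s_def less_Suc_eq\<close>)
    then show ?thesis by simp
  qed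
  finally show "0 \<le> kernel_form ?K n g c" by simp
qed (use neg_type_kernel_sym[OF neg_type] in auto)

lemma neg_type_kernel_realization:
  assumes neg_type: "neg_type_kernel X \<psi>" and countable: "countable X"
  obtains f :: "'x \<Rightarrow> nat \<Rightarrow> real" where
    "\<And>x. x \<in> X \<Longrightarrow> summable (\<lambda>n. (f x n)\<^sup>2)"
    "\<And>x y. x \<in> X \<Longrightarrow> y \<in> X \<Longrightarrow> (\<lambda>n. (f x n - f y n)\<^sup>2) sums \<psi> x y"
proof (cases "X = {}")
  case False
  then obtain e where e_in: "e \<in> X" by blast
  let ?K = "\<lambda>x y. (\<psi> x e + \<psi> y e - \<psi> x y) / 2"
  obtain f :: "'x \<Rightarrow> nat \<Rightarrow> real"
    where f_sums: "\<And>x y. x \<in> X \<Longrightarrow> y \<in> X \<Longrightarrow> (\<lambda>n. f x n * f y n) sums ?K x y"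
    using pd_kernel_realization[OF neg_type_kernel_centered_pd[OF neg_type e_in] countable] by blast
  show ?thesis
  proof (rule that[of f])
    show "summable (\<lambda>n. (f x n)\<^sup>2)" if "x \<in> X" for x
      using f_sums[OF that that] by (auto simp: power2_eq_square sums_iff)
    fix x y assume xy: "x \<in> X" "y \<in> X"
    have "(\<lambda>n. f x n * f x n + f y n * f y n - 2 * (f x n * f y n)) sums (?K x x + ?K y y - 2 * ?K x y)"
      by (intro sums_diff sums_add sums_mult f_sums xy)
    also have "?K x x + ?K y y - 2 * ?K x y = \<psi> x y"
      by (simp add: neg_type_kernel_diag[OF neg_type] xy field_simps)
    finally show "(\<lambda>n. (f x n - f y n)\<^sup>2) sums \<psi> x y"
      by (simp add: power2_eq_square algebra_simps)
  qed
qed (use that in simp)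

section \<open>Embedding criteria\<close>

definition far_pairs :: "'x set \<Rightarrow> ('x \<Rightarrow> 'x \<Rightarrow> real) \<Rightarrow> ('x \<times> 'x) filter" where
  "far_pairs X d = inf (filtercomap (\<lambda>(x, y). d x y) at_top) (principal (X \<times> X))"

lemma eventually_far_pairs:
  "eventually P (far_pairs X d) \<longleftrightarrow> (\<exists>R. \<forall>x\<in>X. \<forall>y\<in>X. R \<le> d x y \<longrightarrow> P (x, y))"
  unfolding far_pairs_def eventually_inf_principal eventually_filtercomap eventually_at_top_linorder
  by (auto 4 4 intro: exI[of _ "{r..}" for r])

lemma eventually_in_far_pairs: "\<forall>\<^sub>F p in far_pairs X d. p \<in> X \<times> X"
  by (simp add: eventually_far_pairs)

definition Hilbert_embeddable :: "'x set \<Rightarrow> ('x \<Rightarrow> 'x \<Rightarrow> real) \<Rightarrow> bool" where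
  "Hilbert_embeddable X d \<longleftrightarrow> (\<exists>f :: 'x \<Rightarrow> nat \<Rightarrow> real. (\<forall>x\<in>X. summable (\<lambda>n. (f x n)\<^sup>2)) \<and>
     (\<exists>\<rho>m \<rho>p. proper_control \<rho>m \<and> proper_control \<rho>p \<and>
        (\<forall>x\<in>X. \<forall>y\<in>X. \<rho>m (d x y) \<le> l2seq_dist (f x) (f y) \<and> l2seq_dist (f x) (f y) \<le> \<rho>p (d x y))))"

lemma proper_control_below:
  fixes D d :: "'x \<Rightarrow> 'x \<Rightarrow> real"
  assumes nonneg: "\<And>x y. x \<in> X \<Longrightarrow> y \<in> X \<Longrightarrow> 0 \<le> D x y"
    and lim: "filterlim (\<lambda>(x, y). D x y) at_top (far_pairs X d)"
  obtains \<rho> where "proper_control \<rho>" "\<And>x y. x \<in> X \<Longrightarrow> y \<in> X \<Longrightarrow> \<rho> (d x y) \<le> D x y"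
proof -
  define A where "A t = insert t {D x y | x y. x \<in> X \<and> y \<in> X \<and> t \<le> d x y}" for t
  have lower: "min t 0 \<le> a" if "a \<in> A t" for t a
    using that nonneg by (fastforce simp: A_def)
  then have bdd: "bdd_below (A t)" for t
    by (rule bdd_belowI)
  have Inf_le: "Inf (A t) \<le> t" for t
    by (rule cInf_lower[OF _ bdd]) (simp add: A_def)
  have "proper_control (\<lambda>t. Inf (A t))"
    unfolding proper_control_def
  proof (intro conjI allI impI)
    show "mono_on {0..} (\<lambda>t. Inf (A t))"
    proof (rule mono_onI)
      fix s t :: real assume "s \<le> t"
      have "Inf (A s) \<le> a" if "a \<in> A t" for a
        using that \<open>s \<le> t\<close> Inf_le[of s] cInf_lower[OF _ bdd, of _ s] by (fastforce simp: A_def)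
      then show "Inf (A s) \<le> Inf (A t)"
        by (intro cInf_greatest) (auto simp: A_def)
    qed
    show "0 \<le> Inf (A t)" if "0 \<le> t" for t
      using lower[of _ t] that by (intro cInf_greatest) (auto simp: A_def)
    show "filterlim (\<lambda>t. Inf (A t)) at_top at_top"
      unfolding filterlim_at_top
    proof
      fix Z :: real
      obtain R where R_bound: "\<And>x y. x \<in> X \<Longrightarrow> y \<in> X \<Longrightarrow> R \<le> d x y \<Longrightarrow> Z \<le> D x y"
        using lim unfolding filterlim_at_top eventually_far_pairs by fastforce
      have "Z \<le> Inf (A t)" if "max R Z \<le> t" for t
        using that R_bound by (intro cInf_greatest) (auto simp: A_def)
      then show "\<forall>\<^sub>F t in at_top. Z \<le> Inf (A t)"
        unfolding eventually_at_top_linorder by blast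
    qed
  qed
  moreover have "Inf (A (d x y)) \<le> D x y" if "x \<in> X" "y \<in> X" for x y
    using that by (intro cInf_lower bdd) (auto simp: A_def)
  ultimately show ?thesis by (rule that)
qed

lemma proper_control_above:
  fixes D d :: "'x \<Rightarrow> 'x \<Rightarrow> real"
  assumes bound: "\<And>r. \<exists>C. \<forall>x\<in>X. \<forall>y\<in>X. d x y \<le> r \<longrightarrow> D x y \<le> C"
  obtains \<rho> where "proper_control \<rho>" "\<And>x y. x \<in> X \<Longrightarrow> y \<in> X \<Longrightarrow> D x y \<le> \<rho> (d x y)"
proof -
  define A where "A t = insert t {D x y | x y. x \<in> X \<and> y \<in> X \<and> d x y \<le> t}" for t
  have bdd: "bdd_above (A t)" for t
  proof -
    obtain C where "\<forall>x\<in>X. \<forall>y\<in>X. d x y \<le> t \<longrightarrow> D x y \<le> C"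
      using bound by blast
    then show ?thesis
      by (intro bdd_aboveI[of _ "max t C"]) (auto simp: A_def le_max_iff_disj)
  qed
  have le_Sup: "t \<le> Sup (A t)" for t
    by (rule cSup_upper[OF _ bdd]) (simp add: A_def)
  have "proper_control (\<lambda>t. Sup (A t))"
    unfolding proper_control_def
  proof (intro conjI allI impI)
    show "mono_on {0..} (\<lambda>t. Sup (A t))"
    proof (rule mono_onI)
      fix s t :: real assume "s \<le> t"
      have "a \<le> Sup (A t)" if "a \<in> A s" for a
        using that \<open>s \<le> t\<close> le_Sup[of t] cSup_upper[OF _ bdd, of _ t] by (fastforce simp: A_def)
      then show "Sup (A s) \<le> Sup (A t)"
        by (intro cSup_least) (auto simp: A_def)
    qed
    show "0 \<le> Sup (A t)" if "0 \<le> t" for t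
      using le_Sup[of t] that by linarith
    show "filterlim (\<lambda>t. Sup (A t)) at_top at_top"
      by (rule filterlim_at_top_mono[OF filterlim_ident]) (simp add: le_Sup)
  qed
  moreover have "D x y \<le> Sup (A (d x y))" if "x \<in> X" "y \<in> X" for x y
    using that by (intro cSup_upper bdd) (auto simp: A_def)
  ultimately show ?thesis by (rule that)
qed

lemma Hilbert_embeddable_of_neg_type_kernel:
  assumes countable: "countable X" and neg_type: "neg_type_kernel X \<psi>"
    and bounded_on_strips: "\<And>r. \<exists>C. \<forall>x\<in>X. \<forall>y\<in>X. d x y \<le> r \<longrightarrow> \<psi> x y \<le> C"
    and proper: "filterlim (\<lambda>(x, y). \<psi> x y) at_top (far_pairs X d)"
  shows "Hilbert_embeddable X d"
proof -
  obtain f :: "'a \<Rightarrow> nat \<Rightarrow> real" where f_summable: "\<And>x. x \<in> X \<Longrightarrow> summable (\<lambda>n. (f x n)\<^sup>2)"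
    and f_sums: "\<And>x y. x \<in> X \<Longrightarrow> y \<in> X \<Longrightarrow> (\<lambda>n. (f x n - f y n)\<^sup>2) sums \<psi> x y"
    using neg_type_kernel_realization[OF neg_type countable] by blast
  have dist: "l2seq_dist (f x) (f y) = sqrt (\<psi> x y)" if "x \<in> X" "y \<in> X" for x y
    using sums_unique[OF f_sums[OF that]] by (simp add: l2seq_dist_def)
  have "filterlim (\<lambda>(x, y). sqrt (\<psi> x y)) at_top (far_pairs X d)"
    using filterlim_compose[OF sqrt_at_top proper] by (simp add: case_prod_unfold)
  then obtain \<rho>m where below: "proper_control \<rho>m" "\<And>x y. x \<in> X \<Longrightarrow> y \<in> X \<Longrightarrow> \<rho>m (d x y) \<le> sqrt (\<psi> x y)"
    using proper_control_below[of X "\<lambda>x y. sqrt (\<psi> x y)" d] neg_type_kernel_nonneg[OF neg_type] by auto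
  have "\<exists>C. \<forall>x\<in>X. \<forall>y\<in>X. d x y \<le> r \<longrightarrow> sqrt (\<psi> x y) \<le> C" for r
    using bounded_on_strips[of r] real_sqrt_le_mono by blast
  then obtain \<rho>p where above: "proper_control \<rho>p" "\<And>x y. x \<in> X \<Longrightarrow> y \<in> X \<Longrightarrow> sqrt (\<psi> x y) \<le> \<rho>p (d x y)"
    using proper_control_above[of X d "\<lambda>x y. sqrt (\<psi> x y)"] by blast
  show ?thesis
    unfolding Hilbert_embeddable_def
    by (intro exI[of _ f] conjI exI[of _ \<rho>m] exI[of _ \<rho>p]) (use f_summable below above dist in auto)
qed

lemma filterlim_suminf_at_top:
  fixes f :: "nat \<Rightarrow> 'p \<Rightarrow> real"
  assumes large: "\<And>n. \<forall>\<^sub>F p in F. 1 \<le> f n p"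
    and summable_nonneg: "\<forall>\<^sub>F p in F. summable (\<lambda>n. f n p) \<and> (\<forall>n. 0 \<le> f n p)"
  shows "filterlim (\<lambda>p. \<Sum>n. f n p) at_top F"
  unfolding filterlim_at_top
proof
  fix Z :: real
  have "\<forall>\<^sub>F p in F. \<forall>n\<in>{..<nat \<lceil>Z\<rceil>}. 1 \<le> f n p"
    using large by (intro eventually_ball_finite) auto
  then show "\<forall>\<^sub>F p in F. Z \<le> (\<Sum>n. f n p)"
    using summable_nonneg
  proof eventually_elim
    case (elim p)
    have "Z \<le> (\<Sum>n<nat \<lceil>Z\<rceil>. 1)" by simp linarith
    also have "\<dots> \<le> (\<Sum>n<nat \<lceil>Z\<rceil>. f n p)"
      using elim by (intro sum_mono) auto
    also have "\<dots> \<le> (\<Sum>n. f n p)"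
      using elim by (intro sum_le_suminf) auto
    finally show ?case .
  qed
qed

lemma Hilbert_embeddable_of_neg_type_series:
  fixes \<psi> :: "nat \<Rightarrow> 'x \<Rightarrow> 'x \<Rightarrow> real"
  assumes countable: "countable X" and neg_type: "\<And>n. neg_type_kernel X (\<psi> n)"
    and bounded: "\<And>n x y. x \<in> X \<Longrightarrow> y \<in> X \<Longrightarrow> \<psi> n x y \<le> C"
    and small: "\<And>n x y. x \<in> X \<Longrightarrow> y \<in> X \<Longrightarrow> d x y \<le> real n \<Longrightarrow> \<psi> n x y \<le> \<epsilon> n"
    and summable_bound: "summable \<epsilon>"
    and large: "\<And>n. \<forall>\<^sub>F (x, y) in far_pairs X d. 1 \<le> \<psi> n x y"
  shows "Hilbert_embeddable X d"
proof (rule Hilbert_embeddable_of_neg_type_kernel[OF countable])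
  note nonneg = neg_type_kernel_nonneg[OF neg_type]
  have summable: "summable (\<lambda>n. \<psi> n x y)" if "x \<in> X" "y \<in> X" for x y
  proof (rule summable_comparison_test'[OF summable_bound])
    fix n assume "nat \<lceil>d x y\<rceil> \<le> n"
    then show "norm (\<psi> n x y) \<le> \<epsilon> n"
      using small[OF that, of n] nonneg[OF that, of n] by simp
  qed
  then show "neg_type_kernel X (\<lambda>x y. \<Sum>n. \<psi> n x y)"
    by (rule neg_type_kernel_suminf[OF neg_type])
  show "\<exists>B. \<forall>x\<in>X. \<forall>y\<in>X. d x y \<le> r \<longrightarrow> (\<Sum>n. \<psi> n x y) \<le> B" for r
  proof (intro exI ballI impI)
    fix x y assume xy: "x \<in> X" "y \<in> X" and near: "d x y \<le> r"
    define k where "k = nat \<lceil>r\<rceil>"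
    have "\<psi> (n + k) x y \<le> \<epsilon> (n + k)" for n
      using near unfolding k_def by (intro small xy) linarith
    then have "(\<Sum>n. \<psi> (n + k) x y) \<le> (\<Sum>n. \<epsilon> (n + k))"
      by (intro suminf_le summable_ignore_initial_segment summable summable_bound xy)
    moreover have "(\<Sum>n<k. \<psi> n x y) \<le> real k * C"
      using sum_mono[of "{..<k}" "\<lambda>n. \<psi> n x y" "\<lambda>_. C"] bounded xy by simp
    ultimately show "(\<Sum>n. \<psi> n x y) \<le> (\<Sum>n. \<epsilon> (n + nat \<lceil>r\<rceil>)) + real (nat \<lceil>r\<rceil>) * C"
      using suminf_split_initial_segment[OF summable[OF xy], of k] by (simp add: k_def)
  qed
  have "\<forall>\<^sub>F p in far_pairs X d. summable (\<lambda>n. \<psi> n (fst p) (snd p)) \<and> (\<forall>n. 0 \<le> \<psi> n (fst p) (snd p))"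
    using eventually_in_far_pairs by (rule eventually_mono) (auto intro: summable nonneg)
  then show "filterlim (\<lambda>(x, y). \<Sum>n. \<psi> n x y) at_top (far_pairs X d)"
    using large filterlim_suminf_at_top[of "\<lambda>n p. \<psi> n (fst p) (snd p)"] by (simp add: case_prod_unfold)
qed

definition approximate_unit_kernel ::
    "'x set \<Rightarrow> ('x \<Rightarrow> 'x \<Rightarrow> real) \<Rightarrow> real \<Rightarrow> real \<Rightarrow> ('x \<Rightarrow> 'x \<Rightarrow> real) \<Rightarrow> bool" where
  "approximate_unit_kernel X d r \<epsilon> u \<longleftrightarrow> pd_kernel X u \<and> (\<forall>x\<in>X. u x x = 1) \<and>
     (\<forall>x\<in>X. \<forall>y\<in>X. d x y \<le> r \<longrightarrow> \<bar>1 - u x y\<bar> \<le> \<epsilon>) \<and>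
     ((\<lambda>(x, y). u x y) \<longlongrightarrow> 0) (far_pairs X d)"

lemma Hilbert_embeddable_of_approximate_unit_kernels:
  assumes countable: "countable X"
    and exists_kernel: "\<And>r \<epsilon>. 0 < \<epsilon> \<Longrightarrow> \<exists>u. approximate_unit_kernel X d r \<epsilon> u"
  shows "Hilbert_embeddable X d"
proof -
  have "\<forall>n :: nat. \<exists>u. approximate_unit_kernel X d (real n) ((1/2) ^ n) u"
    by (intro allI exists_kernel) simp
  then obtain u where u_approximate: "\<And>n :: nat. approximate_unit_kernel X d (real n) ((1/2) ^ n) (u n)"
    by metis
  have pd: "pd_kernel X (u n)" and lim: "((\<lambda>(x, y). u n x y) \<longlongrightarrow> 0) (far_pairs X d)" for n
    using u_approximate by (simp_all add: approximate_unit_kernel_def)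
  have diag: "u n x x = 1" if "x \<in> X" for n x
    using u_approximate that by (simp add: approximate_unit_kernel_def)
  have close: "\<bar>1 - u n x y\<bar> \<le> (1/2) ^ n" if "x \<in> X" "y \<in> X" "d x y \<le> real n" for n x y
    using u_approximate that by (simp add: approximate_unit_kernel_def)
  let ?\<psi> = "\<lambda>n x y. u n x x + u n y y - 2 * u n x y"
  have abs_le: "\<bar>u n x y\<bar> \<le> 1" if "x \<in> X" "y \<in> X" for n x y
    using pd_kernel_Cauchy_Schwarz[OF pd that] that by (simp add: diag abs_square_le_1)
  show ?thesis
  proof (rule Hilbert_embeddable_of_neg_type_series[OF countable neg_type_kernel_of_pd_kernel[OF pd]])
    show "?\<psi> n x y \<le> 4" if "x \<in> X" "y \<in> X" for n x y
      using abs_le[OF that, of n] that by (auto simp: diag)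
    show "?\<psi> n x y \<le> 2 * (1/2) ^ n" if "x \<in> X" "y \<in> X" "d x y \<le> real n" for n x y
      using close[OF that] that by (simp add: diag)
    show "summable (\<lambda>n. 2 * (1/2) ^ n :: real)"
      by (intro summable_mult summable_geometric) simp
    show "\<forall>\<^sub>F (x, y) in far_pairs X d. 1 \<le> ?\<psi> n x y" for n
    proof -
      have "\<forall>\<^sub>F p in far_pairs X d. (case p of (x, y) \<Rightarrow> u n x y) < 1/2"
        using order_tendstoD(2)[OF lim, of "1/2"] by simp
      then show ?thesis
        by (fastforce simp: eventually_far_pairs diag)
    qed
  qed
qed

section \<open>Finite dimensional spaces with a separating family of functionals\<close>

definition biorthogonal ::
    "('x \<Rightarrow> 'v \<Rightarrow> 'k::zero_neq_one) \<Rightarrow> 'v set \<Rightarrow> 'x set \<Rightarrow> ('x \<Rightarrow> 'v) \<Rightarrow> bool" where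
  "biorthogonal \<phi> V P h \<longleftrightarrow> finite P \<and> h ` P \<subseteq> V \<and> (\<forall>p\<in>P. \<forall>q\<in>P. \<phi> p (h q) = (if p = q then 1 else 0))"

context vector_space
begin

context
  fixes \<phi> :: "'x \<Rightarrow> 'b \<Rightarrow> 'a" and V :: "'b set"
  assumes linear: "\<And>x. module_hom scale (*) (\<phi> x)" and subspace_V: "subspace V"
begin

lemma biorthogonal_functional_sum:
  assumes "biorthogonal \<phi> V P h" "p \<in> P"
  shows "\<phi> p (\<Sum>q\<in>P. c q *s h q) = c p"
  using assms
  by (simp add: biorthogonal_def module_hom.sum[OF linear] module_hom.scale[OF linear]
      if_distrib[of "\<lambda>y. _ * y"] cong: if_cong)

lemma biorthogonal_card_le:
  assumes biorth: "biorthogonal \<phi> V P h" and "finite B" "V \<subseteq> span B"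
  shows "card P \<le> card B"
proof -
  have inj: "inj_on h P"
    using biorth unfolding biorthogonal_def by (intro inj_onI) (metis zero_neq_one)
  have "c v = 0" if sum_0: "(\<Sum>v\<in>h ` P. c v *s v) = 0" and v_in: "v \<in> h ` P" for c v
  proof -
    obtain p where "p \<in> P" "v = h p" using v_in by blast
    then show ?thesis
      using biorthogonal_functional_sum[OF biorth, of p "c \<circ> h"] sum_0
      by (simp add: sum.reindex[OF inj] module_hom.zero[OF linear])
  qed
  then have "independent (h ` P)"
    using biorth by (intro independent_if_scalars_zero) (auto simp: biorthogonal_def)
  moreover have "h ` P \<subseteq> span B"
    using biorth assms(3) by (auto simp: biorthogonal_def)
  ultimately show ?thesis
    using independent_span_bound[OF assms(2)] card_image[OF inj] by metis
qed

lemma biorthogonal_insert: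
  assumes biorth: "biorthogonal \<phi> V P h" and "w \<in> V"
    and "\<And>p. p \<in> P \<Longrightarrow> \<phi> p w = 0" "\<phi> q w \<noteq> 0"
  shows "\<exists>h'. biorthogonal \<phi> V (insert q P) h'"
proof -
  define e where "e = (1 / \<phi> q w) *s w"
  have "e \<in> V" "\<phi> q e = 1" "\<And>p. p \<in> P \<Longrightarrow> \<phi> p e = 0" "q \<notin> P"
    using assms by (auto simp: e_def module_hom.scale[OF linear] subspace_scale subspace_V)
  then have "biorthogonal \<phi> V (insert q P) (\<lambda>p. if p = q then e else h p - \<phi> q (h p) *s e)"
    using biorth by (auto simp: biorthogonal_def module_hom.diff[OF linear] module_hom.scale[OF linear]
        intro!: subspace_diff subspace_scale subspace_V)
  then show ?thesis by blast
qed

text \<open>A biorthogonal family of maximal size is a dual basis: otherwise the defect \<open>w\<close> of the expansion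
  of some \<open>v\<close> would extend it.\<close>

lemma dual_basis_of_separating_functionals:
  assumes fin_dim: "finite B" "V \<subseteq> span B"
    and separating: "\<And>v. v \<in> V \<Longrightarrow> (\<And>x. \<phi> x v = 0) \<Longrightarrow> v = 0"
  obtains P h where "finite P" "h ` P \<subseteq> V" "\<And>v. v \<in> V \<Longrightarrow> v = (\<Sum>p\<in>P. \<phi> p v *s h p)"
proof -
  let ?Q = "\<lambda>P. \<exists>h. biorthogonal \<phi> V P h"
  have "?Q {}" by (simp add: biorthogonal_def)
  moreover have "\<forall>P. ?Q P \<longrightarrow> card P < Suc (card B)"
    using biorthogonal_card_le fin_dim by (meson less_Suc_eq_le)
  ultimately obtain P where "?Q P" and P_maximal: "\<And>P'. ?Q P' \<Longrightarrow> card P' \<le> card P"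
    using ex_has_greatest_nat[of ?Q "{}" card "Suc (card B)"] by blast
  then obtain h where biorth: "biorthogonal \<phi> V P h" by blast
  then have finite_P: "finite P" and h_in: "h ` P \<subseteq> V" by (simp_all add: biorthogonal_def)
  show ?thesis
  proof (rule that[OF finite_P h_in])
    fix v assume v_in: "v \<in> V"
    define w where "w = v - (\<Sum>p\<in>P. \<phi> p v *s h p)"
    have "w \<in> V"
      unfolding w_def using h_in v_in by (intro subspace_diff subspace_sum subspace_scale subspace_V) auto
    have vanish: "\<phi> p w = 0" if "p \<in> P" for p
      using biorthogonal_functional_sum[OF biorth that] by (simp add: w_def module_hom.diff[OF linear])
    have "\<phi> q w = 0" for q
    proof (rule ccontr)
      assume nonzero: "\<phi> q w \<noteq> 0"
      then have "card (insert q P) = Suc (card P)"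
        using vanish finite_P by (intro card_insert_disjoint) auto
      then show False
        using P_maximal[OF biorthogonal_insert[OF biorth \<open>w \<in> V\<close> vanish nonzero]] by simp
    qed
    then have "w = 0" using separating \<open>w \<in> V\<close> by blast
    then show "v = (\<Sum>p\<in>P. \<phi> p v *s h p)" by (simp add: w_def)
  qed
qed

end

end

lemma tendsto_zero_on_span:
  fixes scale :: "'k::real_normed_field \<Rightarrow> 'v::ab_group_add \<Rightarrow> 'v" and \<phi> :: "'x \<Rightarrow> 'v \<Rightarrow> 'k"
  assumes "vector_space scale" and linear: "\<And>x. module_hom scale (*) (\<phi> x)"
    and lim: "\<And>w. w \<in> W \<Longrightarrow> ((\<lambda>x. \<phi> x w) \<longlongrightarrow> 0) F"
    and "v \<in> module.span scale W"
  shows "((\<lambda>x. \<phi> x v) \<longlongrightarrow> 0) F"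
proof -
  interpret vector_space scale by fact
  show ?thesis
    using assms(4)
  proof (induction rule: span_induct_alt)
    case base
    show ?case by (simp add: module_hom.zero[OF linear])
  next
    case (step c w v)
    then show ?case
      using tendsto_add[OF tendsto_mult_left[OF lim, of w c]]
      by (simp add: module_hom.add[OF linear] module_hom.scale[OF linear])
  qed
qed

lemma uniform_limit_zero_of_finite_dim:
  fixes scale :: "'k::real_normed_field \<Rightarrow> 'v::ab_group_add \<Rightarrow> 'v" and \<phi> :: "'x \<Rightarrow> 'v \<Rightarrow> 'k"
  assumes vector_space: "vector_space scale" and linear: "\<And>x. module_hom scale (*) (\<phi> x)"
    and separating: "\<And>v. (\<And>x. \<phi> x v = 0) \<Longrightarrow> v = 0"
    and fin_dim: "finite B" "W \<subseteq> module.span scale B"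
    and bounded: "\<And>w x. w \<in> W \<Longrightarrow> norm (\<phi> x w) \<le> C"
    and lim: "\<And>w. w \<in> W \<Longrightarrow> ((\<lambda>x. \<phi> x w) \<longlongrightarrow> 0) F"
  shows "uniform_limit W \<phi> (\<lambda>_. 0) F"
proof -
  interpret vector_space scale by fact
  have span_le: "span W \<subseteq> span B" using fin_dim(2) by (simp add: span_minimal subspace_span)
  obtain P h where P: "finite P" "h ` P \<subseteq> span W"
    and dual_basis: "\<And>v. v \<in> span W \<Longrightarrow> v = (\<Sum>p\<in>P. scale (\<phi> p v) (h p))"
    by (rule dual_basis_of_separating_functionals[where \<phi> = \<phi>,
          OF linear subspace_span fin_dim(1) span_le])
      (rule separating, blast, rule that)
  have majorant_lim: "((\<lambda>x. \<Sum>p\<in>P. C * norm (\<phi> x (h p))) \<longlongrightarrow> 0) F"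
    using P(2) by (intro tendsto_null_sum tendsto_mult_right_zero tendsto_norm_zero
        tendsto_zero_on_span[OF vector_space linear lim]) auto
  have majorant: "norm (\<phi> x w) \<le> (\<Sum>p\<in>P. C * norm (\<phi> x (h p)))" if "w \<in> W" for w x
  proof -
    have "\<phi> x w = \<phi> x (\<Sum>p\<in>P. scale (\<phi> p w) (h p))"
      by (rule arg_cong[OF dual_basis[OF span_base[OF that]]])
    also have "\<dots> = (\<Sum>p\<in>P. \<phi> p w * \<phi> x (h p))"
      by (simp add: module_hom.sum[OF linear] module_hom.scale[OF linear])
    also have "norm \<dots> \<le> (\<Sum>p\<in>P. C * norm (\<phi> x (h p)))"
      by (intro sum_norm_le) (simp add: norm_mult mult_right_mono bounded[OF that])
    finally show ?thesis .
  qed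
  show ?thesis
  proof (rule uniform_limitI)
    fix e :: real assume "0 < e"
    then have "\<forall>\<^sub>F x in F. (\<Sum>p\<in>P. C * norm (\<phi> x (h p))) < e"
      by (rule order_tendstoD(2)[OF majorant_lim])
    then show "\<forall>\<^sub>F x in F. \<forall>w\<in>W. dist (\<phi> x w) 0 < e"
      by (rule eventually_mono) (use majorant in \<open>auto intro: le_less_trans\<close>)
  qed
qed

section \<open>Square summable functions and kernel operators\<close>

definition point_mass :: "'a \<Rightarrow> complex \<Rightarrow> 'a \<Rightarrow> complex" where
  "point_mass t c = (\<lambda>x. if x = t then c else 0)"

lemma has_sum_single_support:
  assumes "t \<in> X" "\<And>x. x \<in> X \<Longrightarrow> x \<noteq> t \<Longrightarrow> f x = 0"
  shows "(f has_sum f t) X"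
  by (rule has_sum_finite_neutralI[of "{t}"]) (use assms in auto)

lemma has_sum_finite_sum:
  fixes f :: "'i \<Rightarrow> 'x \<Rightarrow> 'b::topological_comm_monoid_add"
  assumes "finite I" "\<And>i. i \<in> I \<Longrightarrow> (f i has_sum s i) X"
  shows "((\<lambda>x. \<Sum>i\<in>I. f i x) has_sum (\<Sum>i\<in>I. s i)) X"
  using assms by (induction I rule: finite_induct) (auto intro: has_sum_add)

lemma summable_on_product_of_square_summable:
  fixes \<xi> \<eta> :: "'x \<Rightarrow> complex"
  assumes "(\<lambda>x. (cmod (\<xi> x))\<^sup>2) summable_on X" "(\<lambda>x. (cmod (\<eta> x))\<^sup>2) summable_on X"
  shows "(\<lambda>x. \<xi> x * \<eta> x) summable_on X"
  by (rule abs_summable_summable, rule abs_summable_product)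
    (use assms in \<open>simp_all add: norm_mult power2_eq_square\<close>)

lemma Gram_form_nonneg:
  fixes \<zeta> :: "nat \<Rightarrow> 'x \<Rightarrow> complex"
  assumes "\<And>i. i < n \<Longrightarrow> (\<lambda>x. (cmod (\<zeta> i x))\<^sup>2) summable_on X"
  shows "(\<Sum>i<n. \<Sum>j<n. \<Sum>\<^sub>\<infinity>x\<in>X. \<zeta> j x * cnj (\<zeta> i x)) \<in> \<real>\<^sub>\<ge>\<^sub>0" (is "?S \<in> _")
proof -
  have "((\<lambda>x. \<Sum>i<n. \<Sum>j<n. \<zeta> j x * cnj (\<zeta> i x)) has_sum ?S) X"
    using assms by (intro has_sum_finite_sum has_sum_infsum summable_on_product_of_square_summable) auto
  moreover have "(\<Sum>i<n. \<Sum>j<n. \<zeta> j x * cnj (\<zeta> i x)) = of_real ((cmod (\<Sum>i<n. \<zeta> i x))\<^sup>2)" for x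
    by (subst sum.swap) (simp add: complex_norm_square sum_product del: of_real_power)
  ultimately have sum: "((\<lambda>x. of_real ((cmod (\<Sum>i<n. \<zeta> i x))\<^sup>2)) has_sum ?S) X"
    by simp
  have "0 \<le> Re ?S"
    by (rule has_sum_nonneg[OF has_sum_Re[OF sum]]) simp
  moreover have "Im ?S = 0"
    using has_sum_unique[OF has_sum_Im[OF sum]] by simp
  ultimately show ?thesis by (simp add: complex_nonneg_Reals_iff)
qed

lemma l2_outside: "\<xi> \<in> l2 G \<Longrightarrow> x \<notin> carrier G \<Longrightarrow> \<xi> x = 0"
  by (simp add: l2_def)

lemma l2_summable: "\<xi> \<in> l2 G \<Longrightarrow> (\<lambda>x. (cmod (\<xi> x))\<^sup>2) summable_on carrier G"
  by (simp add: l2_def)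

lemma l2norm_nonneg: "0 \<le> l2norm G \<xi>"
  by (simp add: l2norm_def infsum_nonneg)

lemma L2_set_le_l2norm:
  assumes "\<xi> \<in> l2 G" "finite F" "F \<subseteq> carrier G"
  shows "L2_set (\<lambda>x. cmod (\<xi> x)) F \<le> l2norm G \<xi>"
  unfolding L2_set_def l2norm_def
  by (intro real_sqrt_le_mono finite_sum_le_infsum) (use assms l2_summable in auto)

lemma cmod_le_l2norm:
  assumes "\<xi> \<in> l2 G" "x \<in> carrier G"
  shows "cmod (\<xi> x) \<le> l2norm G \<xi>"
  using L2_set_le_l2norm[OF assms(1), of "{x}"] assms(2) by simp

lemma l2I_bounded_partial_sums:
  assumes "\<And>x. x \<notin> carrier G \<Longrightarrow> \<xi> x = 0"
    and bound: "\<And>F. finite F \<Longrightarrow> F \<subseteq> carrier G \<Longrightarrow> L2_set (\<lambda>x. cmod (\<xi> x)) F \<le> C"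
  shows "\<xi> \<in> l2 G" "l2norm G \<xi> \<le> C"
proof -
  have C_nonneg: "0 \<le> C" using bound[of "{}"] by simp
  have square_sum_le: "(\<Sum>x\<in>F. (cmod (\<xi> x))\<^sup>2) \<le> C\<^sup>2" if "finite F" "F \<subseteq> carrier G" for F
    using bound[OF that] by (simp add: L2_set_def sqrt_le_D)
  have summable: "(\<lambda>x. (cmod (\<xi> x))\<^sup>2) summable_on carrier G"
    by (rule nonneg_bdd_above_summable_on) (use square_sum_le in \<open>auto intro!: bdd_aboveI\<close>)
  then show "\<xi> \<in> l2 G" using assms(1) by (simp add: l2_def)
  have "(\<Sum>\<^sub>\<infinity>x\<in>carrier G. (cmod (\<xi> x))\<^sup>2) \<le> C\<^sup>2"
    by (rule infsum_le_finite_sums[OF summable square_sum_le])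
  then show "l2norm G \<xi> \<le> C"
    unfolding l2norm_def using C_nonneg real_le_lsqrt by (simp add: infsum_nonneg)
qed

lemma l2_diff:
  assumes "\<xi> \<in> l2 G" "\<eta> \<in> l2 G"
  shows "(\<lambda>x. \<xi> x - \<eta> x) \<in> l2 G" "l2norm G (\<lambda>x. \<xi> x - \<eta> x) \<le> l2norm G \<xi> + l2norm G \<eta>"
proof -
  have bound: "L2_set (\<lambda>x. cmod (\<xi> x - \<eta> x)) F \<le> l2norm G \<xi> + l2norm G \<eta>"
    if "finite F" "F \<subseteq> carrier G" for F
  proof -
    have "L2_set (\<lambda>x. cmod (\<xi> x - \<eta> x)) F \<le> L2_set (\<lambda>x. cmod (\<xi> x) + cmod (\<eta> x)) F"
      by (intro L2_set_mono norm_triangle_ineq4) simp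
    also have "\<dots> \<le> L2_set (\<lambda>x. cmod (\<xi> x)) F + L2_set (\<lambda>x. cmod (\<eta> x)) F"
      by (rule L2_set_triangle_ineq)
    finally show ?thesis
      using L2_set_le_l2norm[OF assms(1) that] L2_set_le_l2norm[OF assms(2) that] by linarith
  qed
  have outside: "\<xi> x - \<eta> x = 0" if "x \<notin> carrier G" for x
    using that assms by (simp add: l2_outside)
  show "(\<lambda>x. \<xi> x - \<eta> x) \<in> l2 G" "l2norm G (\<lambda>x. \<xi> x - \<eta> x) \<le> l2norm G \<xi> + l2norm G \<eta>"
    by (rule l2I_bounded_partial_sums[OF outside bound]; assumption)+
qed

lemma
  assumes "t \<in> carrier G"
  shows point_mass_in_l2: "point_mass t c \<in> l2 G"
    and l2norm_point_mass: "l2norm G (point_mass t c) = cmod c"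
proof -
  have "((\<lambda>x. (cmod (point_mass t c x))\<^sup>2) has_sum (cmod (point_mass t c t))\<^sup>2) (carrier G)"
    by (rule has_sum_single_support) (use assms in \<open>auto simp: point_mass_def\<close>)
  then show "point_mass t c \<in> l2 G" "l2norm G (point_mass t c) = cmod c"
    using assms by (auto simp: l2_def l2norm_def point_mass_def summable_on_def dest: infsumI)
qed

lemma kapply_point_mass:
  assumes "s \<in> carrier G" "t \<in> carrier G"
  shows "kapply G A (point_mass t c) s = A s t * c"
proof -
  have "((\<lambda>r. A s r * point_mass t c r) has_sum A s t * point_mass t c t) (carrier G)"
    by (rule has_sum_single_support) (use assms in \<open>auto simp: point_mass_def\<close>)
  then show ?thesis
    using assms by (simp add: kapply_def infsumI point_mass_def)
qed

lemma l2inner_point_mass: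
  assumes "t \<in> carrier G"
  shows "l2inner G \<xi> (point_mass t c) = \<xi> t * cnj c"
proof -
  have "((\<lambda>x. \<xi> x * cnj (point_mass t c x)) has_sum \<xi> t * cnj (point_mass t c t)) (carrier G)"
    by (rule has_sum_single_support) (use assms in \<open>auto simp: point_mass_def\<close>)
  then show ?thesis
    by (simp add: l2inner_def infsumI point_mass_def)
qed

lemma bounded_op_row: "bounded_op G A \<Longrightarrow> s \<in> carrier G \<Longrightarrow> A s \<in> l2 G"
  by (simp add: bounded_op_def)

lemma bounded_op_outside: "bounded_op G A \<Longrightarrow> s \<notin> carrier G \<or> r \<notin> carrier G \<Longrightarrow> A s r = 0"
  by (simp add: bounded_op_def)

lemma bounded_opE:
  assumes "bounded_op G A"
  obtains C where "0 \<le> C" "\<And>\<xi>. \<xi> \<in> l2 G \<Longrightarrow> kapply G A \<xi> \<in> l2 G"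
    "\<And>\<xi>. \<xi> \<in> l2 G \<Longrightarrow> l2norm G (kapply G A \<xi>) \<le> C * l2norm G \<xi>"
proof -
  obtain C where C_bound: "\<And>\<xi>. \<xi> \<in> l2 G \<Longrightarrow> kapply G A \<xi> \<in> l2 G"
    "\<And>\<xi>. \<xi> \<in> l2 G \<Longrightarrow> l2norm G (kapply G A \<xi>) \<le> C * l2norm G \<xi>"
    using assms unfolding bounded_op_def by blast
  have "C * l2norm G \<xi> \<le> max 0 C * l2norm G \<xi>" for \<xi>
    by (intro mult_right_mono l2norm_nonneg) simp
  with C_bound show ?thesis
    by (intro that[of "max 0 C"]) (auto intro: order_trans)
qed

lemma kapply_kdiff:
  assumes "bounded_op G A" "bounded_op G B" "\<xi> \<in> l2 G"
  shows "kapply G (kdiff A B) \<xi> = (\<lambda>s. kapply G A \<xi> s - kapply G B \<xi> s)"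
proof
  fix s
  have "(\<lambda>r. A s r * \<xi> r) summable_on carrier G" "(\<lambda>r. B s r * \<xi> r) summable_on carrier G"
    if "s \<in> carrier G"
    using that assms
    by (auto intro!: summable_on_product_of_square_summable l2_summable bounded_op_row)
  then show "kapply G (kdiff A B) \<xi> s = kapply G A \<xi> s - kapply G B \<xi> s"
    using infsum_add[of "\<lambda>r. A s r * \<xi> r" "carrier G" "\<lambda>r. - (B s r * \<xi> r)"]
    by (simp add: kapply_def kdiff_def left_diff_distrib infsum_uminus summable_on_uminus)
qed

lemma bounded_op_kdiff:
  assumes A_bounded: "bounded_op G A" and B_bounded: "bounded_op G B"
  shows "bounded_op G (kdiff A B)"
proof -
  obtain C where A_bound: "0 \<le> C" "\<And>\<xi>. \<xi> \<in> l2 G \<Longrightarrow> kapply G A \<xi> \<in> l2 G"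
    "\<And>\<xi>. \<xi> \<in> l2 G \<Longrightarrow> l2norm G (kapply G A \<xi>) \<le> C * l2norm G \<xi>"
    by (rule bounded_opE[OF A_bounded]) (rule that)
  obtain D where B_bound: "0 \<le> D" "\<And>\<xi>. \<xi> \<in> l2 G \<Longrightarrow> kapply G B \<xi> \<in> l2 G"
    "\<And>\<xi>. \<xi> \<in> l2 G \<Longrightarrow> l2norm G (kapply G B \<xi>) \<le> D * l2norm G \<xi>"
    by (rule bounded_opE[OF B_bounded]) (rule that)
  have "kapply G (kdiff A B) \<xi> \<in> l2 G \<and> l2norm G (kapply G (kdiff A B) \<xi>) \<le> (C + D) * l2norm G \<xi>"
    if \<xi>_in: "\<xi> \<in> l2 G" for \<xi>
    using l2_diff[OF A_bound(2) B_bound(2), OF \<xi>_in \<xi>_in] A_bound(3)[OF \<xi>_in] B_bound(3)[OF \<xi>_in]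
    by (simp add: kapply_kdiff[OF A_bounded B_bounded \<xi>_in] distrib_right)
  then show ?thesis
    using bounded_op_outside[OF A_bounded] bounded_op_outside[OF B_bounded]
      l2_diff(1)[OF bounded_op_row[OF A_bounded] bounded_op_row[OF B_bounded]]
    unfolding bounded_op_def kdiff_def by auto
qed

lemma l2norm_kapply_le_opnorm:
  assumes "bounded_op G A" "\<xi> \<in> l2 G" "l2norm G \<xi> \<le> 1"
  shows "l2norm G (kapply G A \<xi>) \<le> opnorm G A"
proof -
  obtain C where C_bound: "0 \<le> C" "\<And>\<xi>. \<xi> \<in> l2 G \<Longrightarrow> kapply G A \<xi> \<in> l2 G"
    "\<And>\<xi>. \<xi> \<in> l2 G \<Longrightarrow> l2norm G (kapply G A \<xi>) \<le> C * l2norm G \<xi>"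
    by (rule bounded_opE[OF assms(1)]) (rule that)
  have "bdd_above ((\<lambda>\<xi>. l2norm G (kapply G A \<xi>)) ` {\<xi> \<in> l2 G. l2norm G \<xi> \<le> 1})"
  proof (rule bdd_aboveI2)
    fix \<xi> assume "\<xi> \<in> {\<xi> \<in> l2 G. l2norm G \<xi> \<le> 1}"
    then show "l2norm G (kapply G A \<xi>) \<le> C"
      using C_bound(3)[of \<xi>] mult_left_mono[OF _ C_bound(1), of "l2norm G \<xi>" 1] by simp
  qed
  then show ?thesis
    unfolding opnorm_def using assms(2,3) by (intro cSUP_upper) auto
qed

lemma cmod_entry_le_opnorm:
  assumes A_bounded: "bounded_op G A" and s_in: "s \<in> carrier G" and t_in: "t \<in> carrier G"
  shows "cmod (A s t) \<le> opnorm G A"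
proof -
  have "kapply G A (point_mass t 1) \<in> l2 G"
    using A_bounded point_mass_in_l2[OF t_in] by (blast elim: bounded_opE)
  then have "cmod (A s t) \<le> l2norm G (kapply G A (point_mass t 1))"
    using cmod_le_l2norm s_in kapply_point_mass[OF s_in t_in, of A 1] by fastforce
  also have "\<dots> \<le> opnorm G A"
    using t_in by (intro l2norm_kapply_le_opnorm[OF A_bounded])
      (simp_all add: point_mass_in_l2 l2norm_point_mass)
  finally show ?thesis .
qed

lemma opnorm_zero: "opnorm G (\<lambda>s r. 0) = 0"
proof -
  have "(\<lambda>x. 0) \<in> {\<xi> \<in> l2 G. l2norm G \<xi> \<le> 1}"
    by (simp add: l2_def l2norm_def)
  then have "{\<xi> \<in> l2 G. l2norm G \<xi> \<le> 1} \<noteq> {}" by blast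
  moreover have "kapply G (\<lambda>s r. 0) \<xi> = (\<lambda>x. 0)" for \<xi>
    by (simp add: kapply_def fun_eq_iff)
  ultimately show ?thesis by (simp add: opnorm_def l2norm_def)
qed

section \<open>The left regular representation\<close>

context group
begin

lemma bij_betw_left_mult: "t \<in> carrier G \<Longrightarrow> bij_betw (\<lambda>x. t \<otimes> x) (carrier G) (carrier G)"
  by (simp add: bij_betw_def inj_on_cmult surj_const_mult)

lemma kapply_lreg:
  assumes "t \<in> carrier G" "s \<in> carrier G"
  shows "kapply G (lreg G t) \<xi> s = \<xi> (inv t \<otimes> s)"
proof -
  have "((\<lambda>r. lreg G t s r * \<xi> r) has_sum lreg G t s (inv t \<otimes> s) * \<xi> (inv t \<otimes> s)) (carrier G)"
    by (rule has_sum_single_support) (use assms in \<open>auto simp: lreg_def inv_solve_left\<close>)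
  then show ?thesis
    using assms by (simp add: kapply_def infsumI lreg_def m_assoc[symmetric])
qed

lemma bounded_op_lreg:
  assumes t_in: "t \<in> carrier G"
  shows "bounded_op G (lreg G t)"
proof -
  have "lreg G t s \<in> l2 G" if s_in: "s \<in> carrier G" for s
  proof -
    have "lreg G t s = point_mass (inv t \<otimes> s) 1"
      using s_in t_in by (auto simp: lreg_def point_mass_def fun_eq_iff m_assoc[symmetric])
    then show ?thesis using s_in t_in by (simp add: point_mass_in_l2)
  qed
  moreover have "kapply G (lreg G t) \<xi> \<in> l2 G \<and> l2norm G (kapply G (lreg G t) \<xi>) \<le> 1 * l2norm G \<xi>"
    if \<xi>_in: "\<xi> \<in> l2 G" for \<xi>
  proof -
    have bij: "bij_betw (\<lambda>x. inv t \<otimes> x) (carrier G) (carrier G)"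
      using t_in by (intro bij_betw_left_mult) simp
    have "((\<lambda>x. (cmod (\<xi> x))\<^sup>2) has_sum (l2norm G \<xi>)\<^sup>2) (carrier G)"
      using l2_summable[OF \<xi>_in] by (simp add: l2norm_def infsum_nonneg)
    then have "((\<lambda>x. (cmod (\<xi> (inv t \<otimes> x)))\<^sup>2) has_sum (l2norm G \<xi>)\<^sup>2) (carrier G)"
      by (simp add: has_sum_reindex_bij_betw[OF bij, where f = "\<lambda>x. (cmod (\<xi> x))\<^sup>2"])
    then have "((\<lambda>x. (cmod (kapply G (lreg G t) \<xi> x))\<^sup>2) has_sum (l2norm G \<xi>)\<^sup>2) (carrier G)"
      by (rule has_sum_cong[THEN iffD2, rotated]) (simp add: kapply_lreg t_in)
    then have "(\<lambda>x. (cmod (kapply G (lreg G t) \<xi> x))\<^sup>2) summable_on carrier G"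
      and "l2norm G (kapply G (lreg G t) \<xi>) = l2norm G \<xi>"
      by (auto simp: summable_on_def l2norm_def[of G "kapply G (lreg G t) \<xi>"] infsumI l2norm_nonneg)
    then show ?thesis by (simp add: l2_def kapply_def)
  qed
  moreover have "lreg G t s r = 0" if "s \<notin> carrier G \<or> r \<notin> carrier G" for s r
    using that by (auto simp: lreg_def)
  ultimately show ?thesis unfolding bounded_op_def by blast
qed

lemma lreg_in_reduced_cstar:
  assumes "t \<in> carrier G"
  shows "lreg G t \<in> reduced_cstar G"
  unfolding reduced_cstar_def
proof (intro CollectI conjI bounded_op_lreg assms allI impI)
  fix \<epsilon> :: real assume "0 < \<epsilon>"
  then show "\<exists>F c. finite F \<and> F \<subseteq> carrier G \<and>
      opnorm G (kdiff (lreg G t) (\<lambda>s r. \<Sum>t\<in>F. c t * lreg G t s r)) < \<epsilon>"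
    using assms by (intro exI[of _ "{t}"] exI[of _ "\<lambda>_. 1"]) (simp add: kdiff_def opnorm_zero)
qed

lemma l2inner_lreg_quotient:
  assumes g_in: "g \<in> carrier G" and h_in: "h \<in> carrier G"
  shows "l2inner G (kapply G (lreg G (g \<otimes> inv h)) \<xi>) \<eta> = (\<Sum>\<^sub>\<infinity>y\<in>carrier G. \<xi> (h \<otimes> y) * cnj (\<eta> (g \<otimes> y)))"
proof -
  have "l2inner G (kapply G (lreg G (g \<otimes> inv h)) \<xi>) \<eta> =
      (\<Sum>\<^sub>\<infinity>x\<in>carrier G. \<xi> (inv (g \<otimes> inv h) \<otimes> x) * cnj (\<eta> x))"
    unfolding l2inner_def using g_in h_in by (intro infsum_cong) (simp add: kapply_lreg)
  also have "\<dots> = (\<Sum>\<^sub>\<infinity>y\<in>carrier G. \<xi> (inv (g \<otimes> inv h) \<otimes> (g \<otimes> y)) * cnj (\<eta> (g \<otimes> y)))"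
    by (rule infsum_reindex_bij_betw[OF bij_betw_left_mult[OF g_in], symmetric])
  also have "\<dots> = (\<Sum>\<^sub>\<infinity>y\<in>carrier G. \<xi> (h \<otimes> y) * cnj (\<eta> (g \<otimes> y)))"
  proof (rule infsum_cong)
    fix y assume y_in: "y \<in> carrier G"
    have "inv (g \<otimes> inv h) \<otimes> (g \<otimes> y) = h \<otimes> (inv g \<otimes> (g \<otimes> y))"
      using g_in h_in y_in by (simp add: inv_mult_group m_assoc)
    also have "inv g \<otimes> (g \<otimes> y) = y"
      using g_in y_in by (simp add: m_assoc[symmetric])
    finally show "\<xi> (inv (g \<otimes> inv h) \<otimes> (g \<otimes> y)) * cnj (\<eta> (g \<otimes> y)) = \<xi> (h \<otimes> y) * cnj (\<eta> (g \<otimes> y))"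
      by simp
  qed
  finally show ?thesis .
qed

lemma pos_opmatrix_lreg:
  assumes g_in: "\<And>i. i < n \<Longrightarrow> g i \<in> carrier G"
  shows "pos_opmatrix G n (\<lambda>i j. lreg G (g i \<otimes> inv (g j)))"
  unfolding pos_opmatrix_def Let_def
proof (intro allI impI)
  fix \<eta> :: "nat \<Rightarrow> 'a \<Rightarrow> complex"
  assume \<eta>_in: "\<forall>i<n. \<eta> i \<in> l2 G"
  let ?z = "\<Sum>i<n. \<Sum>j<n. l2inner G (kapply G (lreg G (g i \<otimes> inv (g j))) (\<eta> j)) (\<eta> i)"
  have "?z = (\<Sum>i<n. \<Sum>j<n. \<Sum>\<^sub>\<infinity>y\<in>carrier G. \<eta> j (g j \<otimes> y) * cnj (\<eta> i (g i \<otimes> y)))"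
    using g_in by (intro sum.cong refl l2inner_lreg_quotient) auto
  also have "\<dots> \<in> \<real>\<^sub>\<ge>\<^sub>0"
  proof (rule Gram_form_nonneg)
    fix i assume i_less: "i < n"
    show "(\<lambda>y. (cmod (\<eta> i (g i \<otimes> y)))\<^sup>2) summable_on carrier G"
      using summable_on_reindex_bij_betw[OF bij_betw_left_mult[OF g_in[OF i_less]],
          of "\<lambda>x. (cmod (\<eta> i x))\<^sup>2"]
        l2_summable \<eta>_in i_less by blast
  qed
  finally show "Im ?z = 0 \<and> 0 \<le> Re ?z"
    by (simp add: complex_nonneg_Reals_iff)
qed

end

section \<open>Balls of the word length\<close>

context group
begin

lemma foldr_mult_append:
  assumes "set xs \<subseteq> carrier G" "set ys \<subseteq> carrier G"
  shows "foldr (\<otimes>) (xs @ ys) \<one> = foldr (\<otimes>) xs \<one> \<otimes> foldr (\<otimes>) ys \<one>"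
  using assms by (induction xs) (auto simp: m_assoc)

lemma generate_imp_word:
  assumes symmetric: "S \<subseteq> carrier G" "\<forall>s\<in>S. inv s \<in> S" and g_in: "g \<in> generate G S"
  shows "\<exists>xs. set xs \<subseteq> S \<and> foldr (\<otimes>) xs \<one> = g"
  using g_in
proof (induction rule: generate.induct)
  case one
  show ?case by (intro exI[of _ "[]"]) simp
next
  case (incl h)
  then show ?case using symmetric(1) by (intro exI[of _ "[h]"]) auto
next
  case (inv h)
  then show ?case using symmetric by (intro exI[of _ "[inv h]"]) auto
next
  case (eng h1 h2)
  then obtain xs ys where "set xs \<subseteq> S" "foldr (\<otimes>) xs \<one> = h1" "set ys \<subseteq> S" "foldr (\<otimes>) ys \<one> = h2"
    by blast
  then show ?case
    using foldr_mult_append[of xs ys] symmetric(1) by (intro exI[of _ "xs @ ys"]) auto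
qed

lemma finite_word_length_ball:
  assumes generators: "finite S" "S \<subseteq> carrier G" "\<forall>s\<in>S. inv s \<in> S"
  shows "finite {g \<in> generate G S. real (word_length G S g) \<le> r}" (is "finite ?B")
proof (rule finite_subset)
  let ?W = "{xs. set xs \<subseteq> S \<and> length xs \<le> nat \<lfloor>r\<rfloor>}"
  show "finite ((\<lambda>xs. foldr (\<otimes>) xs \<one>) ` ?W)"
    using generators(1) by (intro finite_imageI finite_lists_length_le)
  show "?B \<subseteq> (\<lambda>xs. foldr (\<otimes>) xs \<one>) ` ?W"
  proof safe
    fix g assume g_ball: "g \<in> generate G S" "real (word_length G S g) \<le> r"
    then have "\<exists>m xs. length xs = m \<and> set xs \<subseteq> S \<and> foldr (\<otimes>) xs \<one> = g"
      using generate_imp_word[OF generators(2,3)] by blast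
    then have "\<exists>xs. length xs = word_length G S g \<and> set xs \<subseteq> S \<and> foldr (\<otimes>) xs \<one> = g"
      unfolding word_length_def by (rule LeastI_ex)
    then show "g \<in> (\<lambda>xs. foldr (\<otimes>) xs \<one>) ` ?W"
      using le_nat_floor[OF g_ball(2)] by (auto simp: image_iff)
  qed
qed

lemma countable_generate:
  assumes "finite S" "S \<subseteq> carrier G" "\<forall>s\<in>S. inv s \<in> S"
  shows "countable (generate G S)"
proof -
  have "generate G S = (\<Union>n. {g \<in> generate G S. real (word_length G S g) \<le> real n})" by auto
  also have "countable \<dots>"
    by (rule countable_UN)
      (simp_all add: countable_finite finite_word_length_ball[OF assms] del: of_nat_le_iff)
  finally show ?thesis .
qed

end

section \<open>Kernels of completely positive maps\<close>

definition complex_pd_kernel :: "'x set \<Rightarrow> ('x \<Rightarrow> 'x \<Rightarrow> complex) \<Rightarrow> bool" where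
  "complex_pd_kernel X K \<longleftrightarrow> (\<forall>n g c. (\<forall>i<n. g i \<in> X) \<longrightarrow>
     (\<Sum>i<(n::nat). \<Sum>j<n. c j * cnj (c i) * K (g i) (g j)) \<in> \<real>\<^sub>\<ge>\<^sub>0)"

lemma complex_pd_kernel_form_nonneg:
  fixes n :: nat
  assumes "complex_pd_kernel X K" "\<And>i. i < n \<Longrightarrow> g i \<in> X"
  shows "(\<Sum>i<n. \<Sum>j<n. c j * cnj (c i) * K (g i) (g j)) \<in> \<real>\<^sub>\<ge>\<^sub>0"
  using assms by (simp add: complex_pd_kernel_def)

lemma complex_pd_kernel_hermitian:
  assumes pd: "complex_pd_kernel X K" and x_in: "x \<in> X" and y_in: "y \<in> X"
  shows "K y x = cnj (K x y)"
proof -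
  let ?g = "\<lambda>i::nat. if i = 0 then x else y"
  have Im_form: "Im (\<Sum>i<2. \<Sum>j<2. c j * cnj (c i) * K (?g i) (?g j)) = 0" for c :: "nat \<Rightarrow> complex"
    using complex_pd_kernel_form_nonneg[OF pd, of 2 ?g c] x_in y_in
    by (simp add: complex_nonneg_Reals_iff)
  have "Im (K x x) = 0" "Im (K y y) = 0"
    using Im_form[of "\<lambda>i. if i = 0 then 1 else 0"] Im_form[of "\<lambda>i. if i = 0 then 0 else 1"]
    by (simp_all add: numeral_2_eq_2)
  then show ?thesis
    using Im_form[of "\<lambda>_. 1"] Im_form[of "\<lambda>i. if i = 0 then 1 else \<i>"]
    by (simp add: numeral_2_eq_2 complex_eq_iff)
qed

text \<open>The second coordinate absorbs complex coefficients; taken of modulus 1, it turns real parts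
  into absolute values.\<close>

lemma pd_kernel_realification:
  assumes pd: "complex_pd_kernel X K"
  shows "pd_kernel (X \<times> UNIV) (\<lambda>(x, a) (y, b). Re (b * cnj a * K x y))" (is "pd_kernel _ ?R")
  unfolding pd_kernel_def
proof (intro conjI ballI allI impI)
  fix p q assume "p \<in> X \<times> (UNIV :: complex set)" "q \<in> X \<times> (UNIV :: complex set)"
  then obtain x a y b where "p = (x, a)" "q = (y, b)" "x \<in> X" "y \<in> X" by auto
  moreover from this have "b * cnj a * K x y = cnj (a * cnj b * K y x)"
    using complex_pd_kernel_hermitian[OF pd, of x y] by simp
  ultimately show "?R p q = ?R q p" by (metis (lifting) case_prod_conv complex_cnj_cnj cnj.sel(1))
next
  fix n and g :: "nat \<Rightarrow> 'a \<times> complex" and c :: "nat \<Rightarrow> real"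
  assume "\<forall>i<n. g i \<in> X \<times> UNIV"
  then have "fst (g i) \<in> X" if "i < n" for i
    using that by (auto simp: mem_Times_iff)
  then have "0 \<le> Re (\<Sum>i<n. \<Sum>j<n. (c j * snd (g j)) * cnj (c i * snd (g i)) * K (fst (g i)) (fst (g j)))"
    using complex_pd_kernel_form_nonneg[OF pd, of n "\<lambda>i. fst (g i)" "\<lambda>i. c i * snd (g i)"]
    by (simp only: complex_nonneg_Reals_iff)
  also have "\<dots> = kernel_form ?R n g c"
    unfolding kernel_form_def Re_sum
    by (intro sum.cong refl) (simp add: case_prod_unfold algebra_simps)
  finally show "0 \<le> kernel_form ?R n g c" .
qed

lemma pd_kernel_Re:
  assumes "complex_pd_kernel X K"
  shows "pd_kernel X (\<lambda>x y. Re (K x y))"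
  using pd_kernel_compose[OF pd_kernel_realification[OF assms], of X "\<lambda>x. (x, 1)"] by simp

lemma complex_pd_kernel_Cauchy_Schwarz:
  assumes pd: "complex_pd_kernel X K" and "x \<in> X" "y \<in> X"
  shows "(cmod (K x y))\<^sup>2 \<le> Re (K x x) * Re (K y y)"
proof -
  define a where "a = (if K x y = 0 then 1 else sgn (K x y))"
  have "cmod a = 1" by (simp add: a_def norm_sgn)
  then have "a * cnj a = 1" by (simp flip: complex_norm_square)
  moreover have "cnj a * K x y = cmod (K x y)"
    by (simp add: a_def sgn_eq complex_norm_square[symmetric] mult.commute power2_eq_square)
  ultimately show ?thesis
    using pd_kernel_Cauchy_Schwarz[OF pd_kernel_realification[OF pd], of "(x, a)" "(y, 1)"] assms(2,3)
    by (simp only: case_prod_conv mem_Times_iff UNIV_I fst_conv snd_conv simp_thms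
        mult_1_left complex_cnj_one Re_complex_of_real)
qed

lemma pos_opmatrix_entries_nonneg:
  assumes positive: "pos_opmatrix G n X" and s_in: "\<And>i. i < n \<Longrightarrow> s i \<in> carrier G"
  shows "(\<Sum>i<n. \<Sum>j<n. c j * cnj (c i) * X i j (s i) (s j)) \<in> \<real>\<^sub>\<ge>\<^sub>0" (is "?S \<in> _")
proof -
  have "?S = (\<Sum>i<n. \<Sum>j<n.
      l2inner G (kapply G (X i j) (point_mass (s j) (c j))) (point_mass (s i) (c i)))"
    using s_in by (intro sum.cong refl) (simp add: l2inner_point_mass kapply_point_mass)
  also have "\<dots> \<in> \<real>\<^sub>\<ge>\<^sub>0"
    using positive s_in unfolding pos_opmatrix_def Let_def complex_nonneg_Reals_iff
    by (auto simp: point_mass_in_l2 dest: spec[of _ "\<lambda>i. point_mass (s i) (c i)"])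
  finally show ?thesis .
qed

lemma (in group) complex_pd_kernel_completely_positive:
  assumes "completely_positive_on G (reduced_cstar G) T"
  shows "complex_pd_kernel (carrier G \<times> carrier G) (\<lambda>(g, s) (h, t). T (lreg G (g \<otimes> inv h)) s t)"
  unfolding complex_pd_kernel_def
proof (intro allI impI)
  fix n and p :: "nat \<Rightarrow> 'a \<times> 'a" and c :: "nat \<Rightarrow> complex"
  assume "\<forall>i<n. p i \<in> carrier G \<times> carrier G"
  then have fst_p_in: "fst (p i) \<in> carrier G" and snd_p_in: "snd (p i) \<in> carrier G" if "i < n" for i
    using that by (auto simp: mem_Times_iff)
  have "pos_opmatrix G n (\<lambda>i j. T (lreg G (fst (p i) \<otimes> inv (fst (p j)))))"
    using assms pos_opmatrix_lreg[of n "\<lambda>i. fst (p i)"] fst_p_in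
    unfolding completely_positive_on_def by (simp add: lreg_in_reduced_cstar)
  then show "(\<Sum>i<n. \<Sum>j<n. c j * cnj (c i) *
      (case p i of (g, s) \<Rightarrow> \<lambda>(h, t). T (lreg G (g \<otimes> inv h)) s t) (p j)) \<in> \<real>\<^sub>\<ge>\<^sub>0"
    using pos_opmatrix_entries_nonneg[of G n _ "\<lambda>i. snd (p i)" c] snd_p_in
    by (simp add: case_prod_unfold)
qed

section \<open>Approximation by finite rank maps into the uniform Roe algebra\<close>

abbreviation word_metric :: "('a, 'b) monoid_scheme \<Rightarrow> 'a set \<Rightarrow> 'a \<Rightarrow> 'a \<Rightarrow> real" where
  "word_metric G S \<equiv> \<lambda>s t. real (word_dist G S s t)"

lemma uniform_roe_tendsto_zero:
  assumes "x \<in> uniform_roe G S"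
  shows "((\<lambda>(s, t). x s t) \<longlongrightarrow> 0) (far_pairs (carrier G) (word_metric G S))"
proof (rule tendstoI)
  fix \<epsilon> :: real assume "0 < \<epsilon>"
  with assms obtain y where x: "bounded_op G x" and y: "bounded_op G y"
    and finite_width: "finite_width G S y" and close: "opnorm G (kdiff x y) < \<epsilon>"
    unfolding uniform_roe_def by blast
  obtain R where vanish:
    "\<And>s t. s \<in> carrier G \<Longrightarrow> t \<in> carrier G \<Longrightarrow> R < word_metric G S s t \<Longrightarrow> y s t = 0"
    using finite_width unfolding finite_width_def by blast
  have "cmod (x s t) < \<epsilon>"
    if st: "s \<in> carrier G" "t \<in> carrier G" and far: "R + 1 \<le> word_metric G S s t" for s t
  proof -
    have "y s t = 0" using vanish[OF st] far by simp
    then have "cmod (x s t) \<le> opnorm G (kdiff x y)"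
      using cmod_entry_le_opnorm[OF bounded_op_kdiff[OF x y] st] by (simp add: kdiff_def)
    then show ?thesis using close by linarith
  qed
  then show "\<forall>\<^sub>F p in far_pairs (carrier G) (word_metric G S). dist (case p of (s, t) \<Rightarrow> x s t) 0 < \<epsilon>"
    unfolding eventually_far_pairs by auto
qed

lemma sum_fun_apply: "(\<Sum>b\<in>B. f b) x = (\<Sum>b\<in>B. f b x)"
  by (induction B rule: infinite_finite_induct) simp_all

lemma vector_space_kernel: "vector_space (\<lambda>(a::complex) (A :: 'a kernel) s t. a * A s t)"
  by standard (simp_all add: fun_eq_iff algebra_simps)

context group
begin

definition ucp_kernel :: "('a kernel \<Rightarrow> 'a kernel) \<Rightarrow> 'a \<Rightarrow> 'a \<Rightarrow> real" where
  "ucp_kernel T s t = Re (T (lreg G (s \<otimes> inv t)) s t)"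

context
  fixes S :: "'a set" and T :: "'a kernel \<Rightarrow> 'a kernel"
  assumes ucp: "fr_ucp_map G S T"
begin

lemma ucp_lreg_in_uniform_roe: "g \<in> carrier G \<Longrightarrow> T (lreg G g) \<in> uniform_roe G S"
  using ucp by (simp add: fr_ucp_map_def lreg_in_reduced_cstar)

lemma ucp_lreg_bounded_op: "g \<in> carrier G \<Longrightarrow> bounded_op G (T (lreg G g))"
  using ucp_lreg_in_uniform_roe by (auto simp: uniform_roe_def)

lemma ucp_lreg_one: "s \<in> carrier G \<Longrightarrow> T (lreg G \<one>) s s = 1"
  using ucp by (simp add: fr_ucp_map_def lreg_def)

lemma complex_pd_kernel_ucp:
  "complex_pd_kernel (carrier G \<times> carrier G) (\<lambda>(g, s) (h, t). T (lreg G (g \<otimes> inv h)) s t)"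
  using ucp by (intro complex_pd_kernel_completely_positive) (simp add: fr_ucp_map_def)

lemma ucp_lreg_entry_le_1:
  assumes g_in: "g \<in> carrier G"
  shows "cmod (T (lreg G g) s t) \<le> 1"
proof (cases "s \<in> carrier G \<and> t \<in> carrier G")
  case True
  then have "(cmod (T (lreg G g) s t))\<^sup>2 \<le> 1"
    using complex_pd_kernel_Cauchy_Schwarz[OF complex_pd_kernel_ucp, of "(g, s)" "(\<one>, t)"] g_in
    by (simp add: ucp_lreg_one)
  then show ?thesis by (simp add: abs_square_le_1)
next
  case False
  then show ?thesis
    using bounded_op_outside[OF ucp_lreg_bounded_op[OF g_in]] by auto
qed

lemma ucp_kernel_diag: "s \<in> carrier G \<Longrightarrow> ucp_kernel T s s = 1"
  by (simp add: ucp_kernel_def ucp_lreg_one)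

lemma pd_kernel_ucp_kernel: "pd_kernel (carrier G) (ucp_kernel T)"
  using pd_kernel_compose[OF pd_kernel_Re[OF complex_pd_kernel_ucp], of "carrier G" "\<lambda>s. (s, s)"]
  by (simp add: ucp_kernel_def[abs_def])

lemma ucp_kernel_close_to_1:
  assumes s_in: "s \<in> carrier G" and t_in: "t \<in> carrier G"
  shows "\<bar>1 - ucp_kernel T s t\<bar> \<le> opnorm G (kdiff (T (lreg G (s \<otimes> inv t))) (lreg G (s \<otimes> inv t)))"
proof -
  let ?g = "s \<otimes> inv t"
  have g_in: "?g \<in> carrier G" using s_in t_in by simp
  have "\<bar>1 - ucp_kernel T s t\<bar> = \<bar>Re (T (lreg G ?g) s t - 1)\<bar>"
    by (simp add: ucp_kernel_def abs_minus_commute)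
  also have "\<dots> \<le> cmod (T (lreg G ?g) s t - 1)"
    by (rule abs_Re_le_cmod)
  also have "\<dots> = cmod (kdiff (T (lreg G ?g)) (lreg G ?g) s t)"
    using s_in t_in by (simp add: kdiff_def lreg_def m_assoc)
  also have "\<dots> \<le> opnorm G (kdiff (T (lreg G ?g)) (lreg G ?g))"
    by (intro cmod_entry_le_opnorm bounded_op_kdiff bounded_op_lreg ucp_lreg_bounded_op g_in s_in t_in)
  finally show ?thesis .
qed

lemma ucp_lreg_uniform_limit_zero:
  "uniform_limit ((\<lambda>g. T (lreg G g)) ` carrier G) (\<lambda>(s, t) A. A s t) (\<lambda>_. 0)
     (far_pairs (carrier G) (word_metric G S))"
proof -
  let ?scale = "\<lambda>(a::complex) (A :: 'a kernel) s t. a * A s t"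
  let ?entry = "\<lambda>(s, t) (A :: 'a kernel). A s t"
  interpret kernels: vector_space ?scale by (rule vector_space_kernel)
  obtain B where "finite B"
    and range: "\<And>x. x \<in> reduced_cstar G \<Longrightarrow> \<exists>c. T x = (\<lambda>s t. \<Sum>b\<in>B. c b * b s t)"
    using ucp unfolding fr_ucp_map_def finite_rank_on_def by blast
  show ?thesis
  proof (rule uniform_limit_zero_of_finite_dim[OF vector_space_kernel _ _ \<open>finite B\<close>])
    show "module_hom ?scale (*) (?entry p)" for p
      by unfold_locales (auto simp: algebra_simps split: prod.split)
    show "A = 0" if "\<And>p. ?entry p A = 0" for A
      using that by (auto simp: fun_eq_iff)
    show "(\<lambda>g. T (lreg G g)) ` carrier G \<subseteq> kernels.span B"
    proof clarify
      fix g assume "g \<in> carrier G"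
      then obtain c where "T (lreg G g) = (\<lambda>s t. \<Sum>b\<in>B. c b * b s t)"
        using range lreg_in_reduced_cstar by blast
      then have "T (lreg G g) = (\<Sum>b\<in>B. ?scale (c b) b)"
        by (simp add: fun_eq_iff sum_fun_apply)
      then show "T (lreg G g) \<in> kernels.span B"
        by (simp add: kernels.span_sum kernels.span_scale kernels.span_base)
    qed
    fix A assume A_in: "A \<in> (\<lambda>g. T (lreg G g)) ` carrier G"
    then show "cmod (?entry p A) \<le> 1" for p
      using ucp_lreg_entry_le_1 by (auto split: prod.split)
    show "((\<lambda>p. ?entry p A) \<longlongrightarrow> 0) (far_pairs (carrier G) (word_metric G S))"
      using A_in uniform_roe_tendsto_zero[OF ucp_lreg_in_uniform_roe] by (auto simp: case_prod_unfold)
  qed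
qed

lemma ucp_kernel_tendsto_zero:
  "((\<lambda>(s, t). ucp_kernel T s t) \<longlongrightarrow> 0) (far_pairs (carrier G) (word_metric G S))"
proof (rule tendstoI)
  fix \<epsilon> :: real assume "0 < \<epsilon>"
  then have "\<forall>\<^sub>F p in far_pairs (carrier G) (word_metric G S).
      \<forall>g\<in>carrier G. cmod (T (lreg G g) (fst p) (snd p)) < \<epsilon>"
    using uniform_limitD[OF ucp_lreg_uniform_limit_zero] by (fastforce simp: case_prod_unfold)
  then show "\<forall>\<^sub>F p in far_pairs (carrier G) (word_metric G S).
      dist (case p of (s, t) \<Rightarrow> ucp_kernel T s t) 0 < \<epsilon>"
    using eventually_in_far_pairs
  proof eventually_elim
    case (elim p)
    then obtain s t where p_eq: "p = (s, t)" "s \<in> carrier G" "t \<in> carrier G" by auto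
    then have "\<bar>ucp_kernel T s t\<bar> \<le> cmod (T (lreg G (s \<otimes> inv t)) s t)"
      by (simp add: ucp_kernel_def abs_Re_le_cmod)
    also have "\<dots> < \<epsilon>" using elim p_eq by simp
    finally show ?case by (simp add: p_eq)
  qed
qed

lemma approximate_unit_kernel_ucp_kernel:
  assumes close: "\<And>g. g \<in> carrier G \<Longrightarrow> real (word_length G S g) \<le> r \<Longrightarrow>
    opnorm G (kdiff (T (lreg G g)) (lreg G g)) \<le> \<epsilon>"
  shows "approximate_unit_kernel (carrier G) (word_metric G S) r \<epsilon> (ucp_kernel T)"
proof -
  have "\<bar>1 - ucp_kernel T s t\<bar> \<le> \<epsilon>"
    if st: "s \<in> carrier G" "t \<in> carrier G" and near: "word_metric G S s t \<le> r" for s t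
  proof -
    have "opnorm G (kdiff (T (lreg G (s \<otimes> inv t))) (lreg G (s \<otimes> inv t))) \<le> \<epsilon>"
      using st near by (intro close) (simp_all add: word_dist_def)
    then show ?thesis using ucp_kernel_close_to_1[OF st] by linarith
  qed
  then show ?thesis
    by (simp add: approximate_unit_kernel_def pd_kernel_ucp_kernel ucp_kernel_diag
        ucp_kernel_tendsto_zero)
qed

end

end

lemma directed_order_finite_common:
  assumes directed: "directed_order leq" and "finite B"
    and eventually_each: "\<And>x. x \<in> B \<Longrightarrow> \<exists>i0. \<forall>i. leq i0 i \<longrightarrow> P x i"
  shows "\<exists>i. \<forall>x\<in>B. P x i"
proof -
  have refl: "leq i i" and trans: "leq i j \<Longrightarrow> leq j k \<Longrightarrow> leq i k"
    and upper: "\<exists>k. leq i k \<and> leq j k" for i j k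
    using directed unfolding directed_order_def by blast+
  have "\<exists>i0. \<forall>x\<in>B. \<forall>i. leq i0 i \<longrightarrow> P x i"
    using \<open>finite B\<close> eventually_each
  proof (induction B rule: finite_induct)
    case (insert x B)
    then obtain j0 where "\<forall>y\<in>B. \<forall>i. leq j0 i \<longrightarrow> P y i" by blast
    moreover obtain i0 where "\<forall>i. leq i0 i \<longrightarrow> P x i" using insert.prems by blast
    moreover obtain k where "leq i0 k" "leq j0 k" using upper by blast
    ultimately show ?case by (intro exI[of _ k]) (auto intro: trans)
  qed simp
  then show ?thesis using refl by blast
qed

theorem theorem3p1:
  fixes G :: "('a, 'b) monoid_scheme" and S :: "'a set"
    and leq :: "'i \<Rightarrow> 'i \<Rightarrow> bool" and T :: "'i \<Rightarrow> 'a kernel \<Rightarrow> 'a kernel"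
  assumes "group G"
    and "finite S" and "S \<subseteq> carrier G" and "\<forall>s\<in>S. inv\<^bsub>G\<^esub> s \<in> S"
    and "generate G S = carrier G"
    and "directed_order leq"
    and "\<forall>i. fr_ucp_map G S (T i)"
    and "\<forall>x\<in>reduced_cstar G. \<forall>\<epsilon>>0. \<exists>i0. \<forall>i. leq i0 i \<longrightarrow> opnorm G (kdiff (T i x) x) < \<epsilon>"
  shows "uniformly_embeddable G S"
proof -
  interpret group G by fact
  have "Hilbert_embeddable (carrier G) (word_metric G S)"
  proof (rule Hilbert_embeddable_of_approximate_unit_kernels)
    show "countable (carrier G)"
      using countable_generate[OF assms(2-4)] assms(5) by simp
    fix r \<epsilon> :: real assume "0 < \<epsilon>"
    let ?B = "{g \<in> carrier G. real (word_length G S g) \<le> r}"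
    have "finite ?B"
      using finite_word_length_ball[OF assms(2-4)] assms(5) by simp
    then have "\<exists>i. \<forall>g\<in>?B. opnorm G (kdiff (T i (lreg G g)) (lreg G g)) < \<epsilon>"
      using assms(8) \<open>0 < \<epsilon>\<close>
      by (intro directed_order_finite_common[OF assms(6)]) (auto simp: lreg_in_reduced_cstar)
    then obtain i where "\<forall>g\<in>?B. opnorm G (kdiff (T i (lreg G g)) (lreg G g)) < \<epsilon>" by blast
    then have "approximate_unit_kernel (carrier G) (word_metric G S) r \<epsilon> (ucp_kernel (T i))"
      using assms(7) by (intro approximate_unit_kernel_ucp_kernel) (auto intro: less_imp_le)
    then show "\<exists>u. approximate_unit_kernel (carrier G) (word_metric G S) r \<epsilon> u" by blast
  qed
  then show ?thesis
    by (simp add: Hilbert_embeddable_def uniformly_embeddable_def)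
qed

end
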